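(* Let $G$ be the free group generated by a countable set of indeterminates $\{x_i\}_{i\ge 1}$, with the dictionary order, let $K$ be a division ring and let $\Phi: G\to \mathrm{Aut}(K)$, $g\mapsto\Phi_g$, be a group homomorphism. Let $D=K((G,\Phi))$ be the corresponding Mal'cev-Neumann division ring. Then, for every positive integer $r$, the multiplicative group $D^*$ contains an almost $r$-subnormal subgroup $N$ which is not subnormal in $D^*$.
   Context: Almost subnormality: an almost normal series of a subgroup $N$ in a group $A$ is a finite series of subgroups $N=N_r\leq N_{r-1}\leq\cdots\leq N_1\leq N_0=A$ such that for each $0\le i<r$, either $N_{i+1}$ is normal in $N_i$ or $[N_i:N_{i+1}]$ is finite; $r$ is its length. $N$ is almost $r$-subnormal in $A$ if it has an almost normal series in $A$ and $r$ is the smallest length of such a series. $N$ is subnormal in $A$ if there is a finite series $N=N_\ell\trianglelefteq N_{\ell-1}\trianglelefteq\cdots\trianglelefteq N_0=A$. Dictionary (Magnus) order on $G$: a total order on the set $G$ such that $a\le b$ implies $ac\le bc$ and $ca\le cb$ for all $a,b,c\in G$, with the generators indexed so that $x_1<x_2<\cdots$. Concretely: embed $G$ in the unit group of the ring of formal power series over $\mathbb{Z}$ in noncommuting variables $X_1,X_2,\ldots$ via $x_i\mapsto 1+X_i$. Compare monomials first by degree and, in equal degree, lexicographically with $X_{i+1}$ preceding $X_i$. Elements of $G$ involve only finitely many variables. For $g\neq h$ in $G$, put $g<h$ if the coefficient of the first monomial occurring with nonzero coefficient in $h-g$ is positive. Mal'cev-Neumann division ring: $K((G,\Phi))$ is the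 set of formal sums $\alpha=\sum_{g\in G}a_g g$ with $a_g\in K$ such that $\mathrm{supp}(\alpha)=\{g\in G\mid a_g\neq 0\}$ is well-ordered (every non-empty subset has a least element) for the order on $G$. For $\alpha=\sum_{g\in G} a_g g$ and $\beta=\sum_{g\in G} b_g g$, the operations are $\alpha+\beta=\sum_{g\in G}(a_g+b_g)g$ and $\alpha\beta=\sum_{t\in G}\bigl(\sum_{gh=t}a_g\Phi_g(b_h)\bigr)t$. This is known to be a division ring. $D^*=D\setminus\{0\}$. *)

theory Defs
  imports "HOL-Algebra.Coset" "HOL-Algebra.Multiplicative_Group"
begin

definition almost_normal_series :: "('a, 'b) monoid_scheme \<Rightarrow> nat \<Rightarrow> (nat \<Rightarrow> 'a set) \<Rightarrow> 'a set \<Rightarrow> bool" where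
  "almost_normal_series A r S N \<longleftrightarrow>
     S 0 = carrier A \<and> S r = N \<and>
     (\<forall>i\<le>r. subgroup (S i) A) \<and>
     (\<forall>i<r. S (Suc i) \<subseteq> S i \<and>
        (S (Suc i) \<lhd> A\<lparr>carrier := S i\<rparr> \<or>
         finite (rcosets\<^bsub>A\<lparr>carrier := S i\<rparr>\<^esub> S (Suc i))))"

definition almost_subnormal :: "('a, 'b) monoid_scheme \<Rightarrow> nat \<Rightarrow> 'a set \<Rightarrow> bool" where
  "almost_subnormal A r N \<longleftrightarrow>
     (\<exists>S. almost_normal_series A r S N) \<and>
     (\<forall>r' S. almost_normal_series A r' S N \<longrightarrow> r \<le> r')"

definition subnormal :: "('a, 'b) monoid_scheme \<Rightarrow> 'a set \<Rightarrow> bool" where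
  "subnormal A N \<longleftrightarrow>
     (\<exists>l S. S 0 = carrier A \<and> S l = N \<and>
        (\<forall>i\<le>l. subgroup (S i) A) \<and>
        (\<forall>i<l. S (Suc i) \<lhd> A\<lparr>carrier := S i\<rparr>))"

text \<open>
  The letter \<open>(i, True)\<close> stands for the \<open>i\<close>-th generator and \<open>(i, False)\<close> for its
  inverse; generators are numbered from \<open>0\<close>, so the first generator has index \<open>0\<close>.
  Group elements are reduced words.
\<close>

type_synonym letter = "nat \<times> bool"
type_synonym fword = "letter list"

definition inv_letter :: "letter \<Rightarrow> letter" where
  "inv_letter p = (fst p, \<not> snd p)"

definition reduced :: "fword \<Rightarrow> bool" where
  "reduced = successively (\<lambda>p q. q \<noteq> inv_letter p)"

fun push_letter :: "letter \<Rightarrow> fword \<Rightarrow> fword" where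
  "push_letter p [] = [p]"
| "push_letter p (q # w) = (if q = inv_letter p then w else p # q # w)"

text \<open>For reduced \<open>u\<close> and \<open>v\<close>, \<open>foldr push_letter u v\<close> is the reduced form of \<open>u @ v\<close>.\<close>

definition free_grp :: "fword monoid" where
  "free_grp = \<lparr>carrier = {w. reduced w},
               mult = (\<lambda>u v. foldr push_letter u v),
               one = []\<rparr>"

text \<open>
  A monomial \<open>X\<^bsub>i1\<^esub> \<dots> X\<^bsub>in\<^esub>\<close> in noncommuting variables is the list \<open>[i1, \<dots>, in]\<close>, and a formal
  power series over the integers is its coefficient function.
\<close>

type_synonym ncseries = "nat list \<Rightarrow> int"

definition ncs_one :: ncseries where
  "ncs_one m = (if m = [] then 1 else 0)"

definition ncs_mult :: "ncseries \<Rightarrow> ncseries \<Rightarrow> ncseries" where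
  "ncs_mult f g m = (\<Sum>k\<le>length m. f (take k m) * g (drop k m))"

text \<open>\<open>1 + X\<^sub>i\<close>, and its inverse, the geometric series \<open>\<Sum>n. (-1)^n X\<^sub>i^n\<close>.\<close>

fun magnus_letter :: "letter \<Rightarrow> ncseries" where
  "magnus_letter (i, True) m = (if m = [] \<or> m = [i] then 1 else 0)"
| "magnus_letter (i, False) m = (if m = replicate (length m) i then (-1) ^ length m else 0)"

definition magnus :: "fword \<Rightarrow> ncseries" where
  "magnus w = foldr (\<lambda>p f. ncs_mult (magnus_letter p) f) w ncs_one"

text \<open>\<open>(m, m') \<in> mono_before\<close>: \<open>m\<close> has smaller degree than \<open>m'\<close>, or the degrees are equal and
  \<open>m\<close> is lexicographically earlier, where the variable of larger index comes first.\<close>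

definition mono_before :: "(nat list \<times> nat list) set" where
  "mono_before = lenlex {(i, j). j < i}"

definition dict_less :: "fword \<Rightarrow> fword \<Rightarrow> bool" where
  "dict_less g h \<longleftrightarrow>
     (\<exists>m. magnus h m - magnus g m > 0 \<and>
          (\<forall>m'. (m', m) \<in> mono_before \<longrightarrow> magnus h m' - magnus g m' = 0))"

definition ring_aut_grp :: "('k::division_ring \<Rightarrow> 'k) monoid" where
  "ring_aut_grp =
     \<lparr>carrier = {f. bij f \<and> f 1 = 1 \<and> (\<forall>a b. f (a + b) = f a + f b) \<and> (\<forall>a b. f (a * b) = f a * f b)},
      mult = (\<circ>),
      one = id\<rparr>"

definition supp :: "(fword \<Rightarrow> 'k::zero) \<Rightarrow> fword set" where
  "supp \<alpha> = {g. \<alpha> g \<noteq> 0}"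

definition dict_well_ordered :: "fword set \<Rightarrow> bool" where
  "dict_well_ordered A \<longleftrightarrow>
     (\<forall>S. S \<subseteq> A \<and> S \<noteq> {} \<longrightarrow> (\<exists>s\<in>S. \<forall>t\<in>S. s = t \<or> dict_less s t))"

text \<open>
  Formal sums are coefficient functions vanishing off the group. In a product, the sum for each
  \<open>t\<close> is restricted to the terms with both coefficients nonzero; since the supports are
  well-ordered there are only finitely many of them.
\<close>

definition malcev_neumann ::
  "(fword \<Rightarrow> 'k::division_ring \<Rightarrow> 'k) \<Rightarrow> (fword \<Rightarrow> 'k) ring" where
  "malcev_neumann \<Phi> =
     \<lparr>carrier = {\<alpha>. supp \<alpha> \<subseteq> carrier free_grp \<and> dict_well_ordered (supp \<alpha>)},
      mult = (\<lambda>\<alpha> \<beta> t. \<Sum>(g, h) \<in> {(g, h). g \<in> supp \<alpha> \<and> h \<in> supp \<beta> \<and> g \<otimes>\<^bsub>free_grp\<^esub> h = t}.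
                        \<alpha> g * \<Phi> g (\<beta> h)),
      one = (\<lambda>g. if g = \<one>\<^bsub>free_grp\<^esub> then 1 else 0),
      zero = (\<lambda>g. 0),
      add = (\<lambda>\<alpha> \<beta> g. \<alpha> g + \<beta> g)\<rparr>"

end

theory Submission
  imports Defs
begin

text \<open>
  The least element of the support of a product of nonzero series is the product of the least
  elements, so taking it is a homomorphism from \<open>D\<^sup>*\<close> onto the free group \<open>G\<close>, and \<open>G\<close> maps onto
  the restricted direct product of countably many copies of the infinite dihedral group, the
  isometries of the integers: of the generators, numbered from \<open>0\<close>, the ones with numbers \<open>2 n\<close> and
  \<open>2 n + 1\<close> become the reflection at \<open>0\<close> and the translation by \<open>1\<close> in coordinate \<open>n\<close>. The subgroup \<open>N\<close>
  consists of the elements that move \<open>0\<close> by a multiple of \<open>3\<close> in coordinate \<open>0\<close> and by a multiple of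
  \<open>2 ^ (r - 1)\<close> in every other coordinate.

  One step of finite index imposes the modulus \<open>3\<close>, and \<open>r - 1\<close> normal steps double the other
  moduli, so \<open>N\<close> has a series of length \<open>r\<close> (\<open>modulus_series\<close>). For the lower bound, take any almost
  normal series of \<open>N\<close>. All its groups contain the reflections. If one of them contains an element that
  is the translation by \<open>a\<close> in coordinate \<open>n\<close>, then after a normal step the next one contains an
  element that is the translation by \<open>2 a\<close> there (\<open>normal_step_doubles\<close>), while a step of finite index
  changes the image in only finitely many coordinates (\<open>finite_index_coordinates\<close>), because elements
  are trivial in almost all coordinates. A series with \<open>k\<close> normal steps thus ends, in almost all
  coordinates, with a translation by \<open>2 ^ k\<close>, so \<open>k \<ge> r - 1\<close>. If all steps were normal, this would hold
  in coordinate \<open>0\<close> as well, and \<open>3\<close> would divide a power of \<open>2\<close>. Hence \<open>N\<close> is not subnormal, some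
  step of every series is not normal, and the length is at least \<open>r\<close>.

  That \<open>D\<^sup>*\<close> is a group has to be shown along the way. The dictionary order is a bi-order because the
  Magnus map is multiplicative and injective: in the image of a reduced word, the monomial with one
  variable per syllable has the product of the exponents as its coefficient
  (\<open>magnus_collapse_pos\<close>). Products of series are well defined by \<open>finite_factorisations\<close> and
  \<open>well_ordered_products\<close>, and an inverse is glued from the partial inverses that agree with it on an
  initial segment (\<open>right_inverse_exists\<close>).
\<close>

section \<open>The free group of reduced words\<close>

lemma inv_letter_inv_letter [simp]: "inv_letter (inv_letter p) = p"
  by (simp add: inv_letter_def)

lemma reduced_Nil [simp]: "reduced []"
  by (simp add: reduced_def)

lemma reduced_single [simp]: "reduced [p]"
  by (simp add: reduced_def)

lemma reduced_Cons2 [simp]: "reduced (p # q # w) \<longleftrightarrow> q \<noteq> inv_letter p \<and> reduced (q # w)"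
  by (simp add: reduced_def)

lemma reduced_ConsD: "reduced (p # w) \<Longrightarrow> reduced w"
  by (cases w) auto

lemma reduced_push_letter: "reduced w \<Longrightarrow> reduced (push_letter p w)"
  by (cases w) (auto dest: reduced_ConsD)

lemma push_letter_cancel:
  assumes "reduced w"
  shows "push_letter (inv_letter p) (push_letter p w) = w"
proof (cases w)
  case (Cons q w')
  then show ?thesis
    using assms by (cases w') auto
qed auto

lemma push_letter_cancel':
  "reduced w \<Longrightarrow> push_letter p (push_letter (inv_letter p) w) = w"
  using push_letter_cancel[of w "inv_letter p"] by simp

lemma reduced_foldr_push: "reduced w \<Longrightarrow> reduced (foldr push_letter u w)"
  by (induction u) (auto intro: reduced_push_letter)

lemma foldr_push_letter_push:
  assumes "reduced w"
  shows "foldr push_letter (push_letter p v) w = push_letter p (foldr push_letter v w)"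
  by (cases v) (auto simp: push_letter_cancel' reduced_foldr_push assms)

lemma foldr_push_assoc:
  assumes "reduced w"
  shows "foldr push_letter (foldr push_letter u v) w = foldr push_letter u (foldr push_letter v w)"
  by (induction u) (auto simp: foldr_push_letter_push assms)

lemma foldr_push_Nil: "reduced u \<Longrightarrow> foldr push_letter u [] = u"
proof (induction u)
  case (Cons p u)
  then show ?case
    by (cases u) (auto dest: reduced_ConsD)
qed auto

lemma foldr_push_inverse:
  "reduced w \<Longrightarrow> foldr push_letter (rev (map inv_letter u)) (foldr push_letter u w) = w"
  by (induction u) (auto simp: push_letter_cancel reduced_foldr_push)

lemma carrier_free_grp: "carrier free_grp = {w. reduced w}"
  and mult_free_grp: "u \<otimes>\<^bsub>free_grp\<^esub> v = foldr push_letter u v"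
  and one_free_grp: "\<one>\<^bsub>free_grp\<^esub> = []"
  by (simp_all add: free_grp_def)

lemma group_free_grp: "group free_grp"
proof (rule groupI)
  fix u assume u: "u \<in> carrier free_grp"
  let ?v = "foldr push_letter (rev (map inv_letter u)) []"
  have "foldr push_letter ?v u = []"
    using u foldr_push_inverse[of "[]" u]
    by (simp add: carrier_free_grp foldr_push_assoc foldr_push_Nil)
  then show "\<exists>v\<in>carrier free_grp. v \<otimes>\<^bsub>free_grp\<^esub> u = \<one>\<^bsub>free_grp\<^esub>"
    by (intro bexI[of _ ?v])
       (simp_all add: carrier_free_grp mult_free_grp one_free_grp reduced_foldr_push)
qed (auto simp: carrier_free_grp mult_free_grp one_free_grp reduced_foldr_push foldr_push_assoc)

section \<open>The Magnus embedding\<close>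

text \<open>The recursion of the product along the first variable of the monomial; the coefficient
  function \<open>\<lambda>x. f (a # x)\<close> collects the terms of \<open>f\<close> that begin with \<open>X\<^sub>a\<close>.\<close>

lemma ncs_mult_Nil [simp]: "ncs_mult f g [] = f [] * g []"
  by (simp add: ncs_mult_def)

lemma ncs_mult_Cons:
  "ncs_mult f g (a # m) = f [] * g (a # m) + ncs_mult (\<lambda>x. f (a # x)) g m"
  by (simp add: ncs_mult_def sum.atMost_Suc_shift del: sum.atMost_Suc)

lemma ncs_mult_add_left: "ncs_mult (\<lambda>x. f x + g x) h m = ncs_mult f h m + ncs_mult g h m"
  by (simp add: ncs_mult_def distrib_right sum.distrib)

lemma ncs_mult_scale_left: "ncs_mult (\<lambda>x. c * f x) h m = c * ncs_mult f h m"
  by (simp add: ncs_mult_def sum_distrib_left mult.assoc)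

lemma ncs_mult_uminus_left: "ncs_mult (\<lambda>x. - f x) h m = - ncs_mult f h m"
  by (simp add: ncs_mult_def sum_negf)

lemma ncs_mult_zero_left [simp]: "ncs_mult (\<lambda>x. 0) h m = 0"
  by (simp add: ncs_mult_def)

lemma ncs_mult_assoc: "ncs_mult (ncs_mult f g) h = ncs_mult f (ncs_mult g h)"
proof
  show "ncs_mult (ncs_mult f g) h m = ncs_mult f (ncs_mult g h) m" for m
  proof (induction m arbitrary: f g h)
    case (Cons a m)
    show ?case
      by (simp add: ncs_mult_Cons ncs_mult_add_left ncs_mult_scale_left Cons.IH algebra_simps)
  qed simp
qed

lemma ncs_one_Cons [simp]: "ncs_one (a # m) = 0"
  and ncs_one_Nil [simp]: "ncs_one [] = 1"
  by (simp_all add: ncs_one_def)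

lemma ncs_mult_one_left [simp]: "ncs_mult ncs_one f = f"
proof
  show "ncs_mult ncs_one f m = f m" for m
    by (cases m) (simp_all add: ncs_mult_Cons)
qed

lemma magnus_letter_Nil [simp]: "magnus_letter p [] = 1"
  by (cases "(p, [] :: nat list)" rule: magnus_letter.cases) auto

lemma magnus_letter_True_Cons:
  "(\<lambda>x. magnus_letter (i, True) (a # x)) = (if a = i then ncs_one else (\<lambda>x. 0))"
  by (auto simp: ncs_one_def fun_eq_iff)

lemma magnus_letter_False_Cons:
  "(\<lambda>x. magnus_letter (i, False) (a # x)) =
     (if a = i then (\<lambda>x. - magnus_letter (i, False) x) else (\<lambda>x. 0))"
  by (auto simp: fun_eq_iff)

lemma magnus_letter_False_single [simp]: "magnus_letter (i, False) [i] = -1"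
  by simp

lemma magnus_letter_inverse: "ncs_mult (magnus_letter p) (magnus_letter (inv_letter p)) = ncs_one"
proof
  fix m
  obtain i b where p: "p = (i, b)" by fastforce
  show "ncs_mult (magnus_letter p) (magnus_letter (inv_letter p)) m = ncs_one m"
  proof (cases b)
    case True
    then show ?thesis
      by (cases m) (auto simp: p inv_letter_def ncs_mult_Cons magnus_letter_True_Cons
          simp del: magnus_letter.simps(1))
  next
    case False
    show ?thesis
    proof (induction m)
      case (Cons a m)
      then show ?case
        using False
        by (cases m) (auto simp: p inv_letter_def ncs_mult_Cons magnus_letter_False_Cons
            ncs_mult_uminus_left magnus_letter.simps(1) simp del: magnus_letter.simps(2))
    qed simp
  qed
qed

lemma magnus_Nil [simp]: "magnus [] = ncs_one"
  by (simp add: magnus_def)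

lemma magnus_Cons: "magnus (p # w) = ncs_mult (magnus_letter p) (magnus w)"
  by (simp add: magnus_def)

lemma magnus_const [simp]: "magnus w [] = 1"
  by (induction w) (simp_all add: magnus_Cons)

lemma magnus_push_letter: "magnus (push_letter p w) = ncs_mult (magnus_letter p) (magnus w)"
  by (cases w)
     (auto simp: magnus_Cons magnus_letter_inverse simp flip: ncs_mult_assoc)

lemma magnus_mult: "magnus (foldr push_letter u v) = ncs_mult (magnus u) (magnus v)"
  by (induction u) (simp_all add: magnus_push_letter magnus_Cons ncs_mult_assoc)

text \<open>The exponent of a letter.\<close>

definition letter_sign :: "letter \<Rightarrow> int" where
  "letter_sign p = (if snd p then 1 else -1)"

lemma magnus_letter_False_mult:
  assumes "m = [] \<or> hd m \<noteq> i"
  shows "ncs_mult (magnus_letter (i, False)) f m = f m"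
  using assms by (cases m) (simp_all add: ncs_mult_Cons magnus_letter_False_Cons
      del: magnus_letter.simps)

text \<open>On a monomial without adjacent equal variables, \<open>x\<^sub>i\<close> and its inverse act like
  \<open>1 + X\<^sub>i\<close> and \<open>1 - X\<^sub>i\<close>: the higher powers of \<open>X\<^sub>i\<close> do not contribute.\<close>

lemma magnus_Cons_distinct_adj:
  assumes "distinct_adj (a # m)"
  shows "magnus (p # w) (a # m) =
    magnus w (a # m) + (if a = fst p then letter_sign p * magnus w m else 0)"
proof (cases p)
  case (Pair i b)
  have m: "m = [] \<or> hd m \<noteq> a"
    using assms by (cases m) auto
  show ?thesis
    using m by (cases b)
      (auto simp: Pair magnus_Cons ncs_mult_Cons magnus_letter_True_Cons magnus_letter_False_Cons
          letter_sign_def ncs_mult_uminus_left magnus_letter_False_mult simp del: magnus_letter.simps)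
qed

text \<open>The monomial with one variable for each syllable of a word.\<close>

definition collapse :: "fword \<Rightarrow> nat list" where
  "collapse w = remdups_adj (map fst w)"

lemma collapse_Nil [simp]: "collapse [] = []"
  and collapse_single [simp]: "collapse [p] = [fst p]"
  and collapse_Cons2 [simp]: "collapse (p # q # w) =
    (if fst p = fst q then collapse (q # w) else fst p # collapse (q # w))"
  by (simp_all add: collapse_def)

lemma hd_collapse [simp]: "hd (collapse (p # w)) = fst p"
  by (simp add: collapse_def hd_remdups_adj)

lemma collapse_Cons_neq_Nil [simp]: "collapse (p # w) \<noteq> []"
  by (simp add: collapse_def)

lemma distinct_adj_collapse [simp]: "distinct_adj (collapse w)"
  by (simp add: collapse_def)

text \<open>On monomials without adjacent equal variables, the coefficients vanish beyond the collapsed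
  monomial: on every longer one, and on every one of equal length with another first variable.\<close>

lemma magnus_eq_0_beyond_collapse:
  assumes "distinct_adj m"
    and "length m > length (collapse w) \<or>
         length m = length (collapse w) \<and> m \<noteq> [] \<and> hd m \<noteq> hd (collapse w)"
  shows "magnus w m = 0"
  using assms
proof (induction w arbitrary: m)
  case Nil
  then show ?case by (cases m) auto
next
  case (Cons p w)
  obtain a m' where m: "m = a # m'"
    using Cons.prems by (cases m) auto
  have m': "distinct_adj m'" "m' = [] \<or> hd m' \<noteq> a"
    using Cons.prems(1) by (auto simp: m distinct_adj_Cons)
  show ?case
  proof (cases w)
    case Nil
    then show ?thesis
      using Cons.prems unfolding m magnus_Cons_distinct_adj[OF Cons.prems(1)[unfolded m]]
      by (auto simp: ncs_one_def)
  next
    case w: (Cons q w')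
    have "magnus w m = 0"
      using Cons.prems by (intro Cons.IH) (auto simp: w m split: if_splits)
    moreover have "magnus w m' = 0" if "a = fst p"
      using Cons.prems m' that by (intro Cons.IH) (auto simp: w m split: if_splits)
    ultimately show ?thesis
      using Cons.prems(1) by (simp add: m magnus_Cons_distinct_adj)
  qed
qed

text \<open>The coefficient of the collapsed monomial is the product of the syllable exponents, so it
  does not vanish. The induction over the letters carries the sign of the first exponent.\<close>

lemma magnus_collapse_pos:
  assumes "reduced (p # w)"
  shows "letter_sign p * magnus (p # w) (collapse (p # w))
           * magnus (p # w) (tl (collapse (p # w))) > 0"
  using assms
proof (induction w arbitrary: p)
  case Nil
  show ?case
    by (simp add: magnus_Cons_distinct_adj) (simp add: letter_sign_def)
next
  case (Cons q w)
  have red: "reduced (q # w)" and neq: "q \<noteq> inv_letter p"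
    using Cons.prems by auto
  obtain m where m: "collapse (q # w) = fst q # m"
    by (metis collapse_Cons_neq_Nil hd_collapse list.collapse)
  have adj: "distinct_adj (fst q # m)"
    using distinct_adj_collapse[of "q # w"] by (simp only: m)
  have sq: "letter_sign p * letter_sign p = 1"
    by (simp add: letter_sign_def)
  have IH: "letter_sign q * magnus (q # w) (fst q # m) * magnus (q # w) m > 0"
    using Cons.IH[OF red] by (simp add: m)
  have keep: "magnus (p # q # w) n = magnus (q # w) n"
    if "distinct_adj n" "n = [] \<or> hd n \<noteq> fst p" for n
    using that by (cases n) (simp_all add: magnus_Cons_distinct_adj)
  show ?case
  proof (cases "fst p = fst q")
    case True
    then have pq: "p = q"
      using neq by (auto simp: inv_letter_def prod_eq_iff)
    have nz: "magnus (q # w) m \<noteq> 0"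
      using IH by auto
    have km: "magnus (q # q # w) m = magnus (q # w) m"
      using keep[of m] adj by (auto simp: pq distinct_adj_Cons)
    have "letter_sign q * magnus (q # q # w) (fst q # m) * magnus (q # q # w) m =
      letter_sign q * magnus (q # w) (fst q # m) * magnus (q # w) m
        + (letter_sign q * letter_sign q) * (magnus (q # w) m * magnus (q # w) m)"
      unfolding km magnus_Cons_distinct_adj[OF adj, of q "q # w"] by (simp add: algebra_simps)
    moreover have "magnus (q # w) m * magnus (q # w) m > 0"
      using nz by (auto simp: zero_less_mult_iff)
    ultimately have "letter_sign q * magnus (q # q # w) (fst q # m) * magnus (q # q # w) m > 0"
      using IH sq pq by simp
    then show ?thesis
      by (simp add: pq m)
  next
    case False
    let ?c = "collapse (q # w)"
    have adj': "distinct_adj (fst p # ?c)"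
      using False adj by (simp add: m)
    have nz: "magnus (q # w) ?c \<noteq> 0"
      using IH by (auto simp: m)
    have zero: "magnus (q # w) (fst p # ?c) = 0"
      using adj' by (intro magnus_eq_0_beyond_collapse) auto
    have kc: "magnus (p # q # w) ?c = magnus (q # w) ?c"
      using False by (intro keep) auto
    have "letter_sign p * magnus (p # q # w) (fst p # ?c) * magnus (p # q # w) ?c =
      (letter_sign p * letter_sign p) * (magnus (q # w) ?c * magnus (q # w) ?c)"
      unfolding kc magnus_Cons_distinct_adj[OF adj', of p "q # w"] zero
      by (simp add: algebra_simps)
    moreover have "magnus (q # w) ?c * magnus (q # w) ?c > 0"
      using nz by (auto simp: zero_less_mult_iff)
    ultimately show ?thesis
      using False sq by simp
  qed
qed

lemma magnus_eq_one_iff: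
  assumes "reduced w"
  shows "magnus w = ncs_one \<longleftrightarrow> w = []"
proof (cases w)
  case (Cons p w')
  then have "magnus w (collapse w) \<noteq> 0"
    using magnus_collapse_pos[of p w'] assms by auto
  then show ?thesis
    by (auto simp: Cons ncs_one_def)
qed auto

lemma magnus_inj:
  assumes "reduced u" "reduced v" "magnus u = magnus v"
  shows "u = v"
proof -
  interpret group free_grp by (rule group_free_grp)
  have uv: "u \<in> carrier free_grp" "v \<in> carrier free_grp"
    using assms by (simp_all add: carrier_free_grp)
  let ?w = "inv\<^bsub>free_grp\<^esub> u"
  have "magnus (?w \<otimes>\<^bsub>free_grp\<^esub> v) = magnus (?w \<otimes>\<^bsub>free_grp\<^esub> u)"
    by (simp add: mult_free_grp magnus_mult assms(3))
  also have "\<dots> = ncs_one"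
    using uv by (simp add: one_free_grp)
  finally have "?w \<otimes>\<^bsub>free_grp\<^esub> v = \<one>\<^bsub>free_grp\<^esub>"
    using uv magnus_eq_one_iff[of "?w \<otimes>\<^bsub>free_grp\<^esub> v"] m_closed[of ?w v] inv_closed[of u]
    by (simp add: carrier_free_grp one_free_grp)
  then show ?thesis
    using uv by (metis inv_closed inv_equality inv_inv l_inv)
qed

lemma magnus_support:
  assumes "magnus w m \<noteq> 0"
  shows "set m \<subseteq> fst ` set w"
  using assms
proof (induction w arbitrary: m)
  case (Cons p w)
  have letter: "set x \<subseteq> {fst p}" if "magnus_letter p x \<noteq> 0" for x
  proof (cases p)
    case (Pair i b)
    have "x = [] \<or> x = [i] \<or> x = replicate (length x) i"
      using that by (cases b) (auto simp: Pair split: if_splits)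
    then show ?thesis
      by (metis Pair empty_iff fst_conv in_set_replicate insert_iff list.set(1) list.simps(15)
          subsetI)
  qed
  obtain k where "magnus_letter p (take k m) * magnus w (drop k m) \<noteq> 0"
    using Cons.prems unfolding magnus_Cons ncs_mult_def
    by (meson sum.not_neutral_contains_not_neutral)
  then have "set (take k m) \<subseteq> {fst p}" "set (drop k m) \<subseteq> fst ` set w"
    using letter Cons.IH by auto
  then show ?case
    by (metis (no_types, lifting) Un_mono append_take_drop_id image_insert insert_is_Un
        list.simps(15) set_append)
qed (auto simp: ncs_one_def split: if_splits)

section \<open>Well-ordered subsets of an ordered group\<close>

text \<open>A bi-ordered group. Irreflexivity and transitivity hold on the whole type, the other axioms
  on the carrier.\<close>

locale ordered_group = group +
  fixes less :: "'a \<Rightarrow> 'a \<Rightarrow> bool"  (infix \<open>\<prec>\<close> 50)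
  assumes irrefl: "\<not> x \<prec> x"
    and trans: "x \<prec> y \<Longrightarrow> y \<prec> z \<Longrightarrow> x \<prec> z"
    and total: "x \<in> carrier G \<Longrightarrow> y \<in> carrier G \<Longrightarrow> x \<noteq> y \<Longrightarrow> x \<prec> y \<or> y \<prec> x"
    and mult_strict_left_mono:
      "x \<in> carrier G \<Longrightarrow> y \<in> carrier G \<Longrightarrow> z \<in> carrier G \<Longrightarrow> x \<prec> y \<Longrightarrow> z \<otimes> x \<prec> z \<otimes> y"
    and mult_strict_right_mono:
      "x \<in> carrier G \<Longrightarrow> y \<in> carrier G \<Longrightarrow> z \<in> carrier G \<Longrightarrow> x \<prec> y \<Longrightarrow> x \<otimes> z \<prec> y \<otimes> z"
begin

definition le :: "'a \<Rightarrow> 'a \<Rightarrow> bool"  (infix \<open>\<preceq>\<close> 50) where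
  "x \<preceq> y \<longleftrightarrow> x = y \<or> x \<prec> y"

lemma le_refl [simp]: "x \<preceq> x"
  by (simp add: le_def)

lemma le_trans: "x \<preceq> y \<Longrightarrow> y \<preceq> z \<Longrightarrow> x \<preceq> z"
  unfolding le_def using trans by blast

lemma le_less_trans: "x \<preceq> y \<Longrightarrow> y \<prec> z \<Longrightarrow> x \<prec> z"
  unfolding le_def using trans by blast

lemma less_imp_le: "x \<prec> y \<Longrightarrow> x \<preceq> y"
  by (simp add: le_def)

lemma le_antisym: "x \<preceq> y \<Longrightarrow> y \<preceq> x \<Longrightarrow> x = y"
  unfolding le_def using trans irrefl by blast

lemma not_less: "x \<preceq> y \<Longrightarrow> \<not> y \<prec> x"
  unfolding le_def using trans irrefl by blast

lemma linear: "x \<in> carrier G \<Longrightarrow> y \<in> carrier G \<Longrightarrow> x \<preceq> y \<or> y \<prec> x"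
  unfolding le_def using total by blast

lemma mult_mono:
  assumes "a \<in> carrier G" "a' \<in> carrier G" "b \<in> carrier G" "b' \<in> carrier G"
    and "a \<preceq> a'" "b \<preceq> b'"
  shows "a \<otimes> b \<preceq> a' \<otimes> b'"
proof -
  have "a \<otimes> b \<preceq> a' \<otimes> b" "a' \<otimes> b \<preceq> a' \<otimes> b'"
    using assms mult_strict_left_mono mult_strict_right_mono by (auto simp: le_def)
  then show ?thesis
    by (rule le_trans)
qed

text \<open>Two factorisations of one element: the larger left factor has the smaller right factor.\<close>

lemma mult_eq_anti:
  assumes "a \<in> carrier G" "a' \<in> carrier G" "b \<in> carrier G" "b' \<in> carrier G"
    and "a \<otimes> b \<preceq> a' \<otimes> b'" "a' \<prec> a"
  shows "b \<prec> b'"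
proof (rule ccontr)
  assume "\<not> b \<prec> b'"
  then have "b' \<preceq> b"
    using linear assms by blast
  then have "a' \<otimes> b' \<preceq> a' \<otimes> b"
    using mult_mono assms by auto
  moreover have "a' \<otimes> b \<prec> a \<otimes> b"
    using mult_strict_right_mono assms by auto
  ultimately show False
    using assms(5) le_less_trans not_less by blast
qed

definition well_ordered :: "'a set \<Rightarrow> bool" where
  "well_ordered A \<longleftrightarrow> (\<forall>S. S \<subseteq> A \<and> S \<noteq> {} \<longrightarrow> (\<exists>s\<in>S. \<forall>t\<in>S. s \<preceq> t))"

lemma well_ordered_subset: "well_ordered A \<Longrightarrow> B \<subseteq> A \<Longrightarrow> well_ordered B"
  unfolding well_ordered_def by blast

lemma obtain_least:
  assumes "well_ordered A" "S \<subseteq> A" "S \<noteq> {}"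
  obtains s where "s \<in> S" "\<forall>t\<in>S. s \<preceq> t"
  using assms unfolding well_ordered_def by blast

lemma well_ordered_Un:
  assumes "well_ordered A" "well_ordered B" "A \<subseteq> carrier G" "B \<subseteq> carrier G"
  shows "well_ordered (A \<union> B)"
  unfolding well_ordered_def
proof (intro allI impI, elim conjE)
  fix S assume S: "S \<subseteq> A \<union> B" "S \<noteq> {}"
  show "\<exists>s\<in>S. \<forall>t\<in>S. s \<preceq> t"
  proof (cases "S \<inter> A = {} \<or> S \<inter> B = {}")
    case True
    then have "S \<subseteq> A \<or> S \<subseteq> B"
      using S by blast
    then show ?thesis
      using assms S unfolding well_ordered_def by blast
  next
    case False
    obtain a where a: "a \<in> S \<inter> A" "\<forall>t\<in>S \<inter> A. a \<preceq> t"
      using obtain_least[OF assms(1), of "S \<inter> A"] False by blast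
    obtain b where b: "b \<in> S \<inter> B" "\<forall>t\<in>S \<inter> B. b \<preceq> t"
      using obtain_least[OF assms(2), of "S \<inter> B"] False by blast
    have "a \<preceq> b \<or> b \<preceq> a"
      using linear[of a b] less_imp_le a b assms(3,4) by blast
    then show ?thesis
    proof
      assume "a \<preceq> b"
      then have "\<forall>t\<in>S. a \<preceq> t"
        using a(2) b(2) S(1) le_trans[of a b] by blast
      then show ?thesis
        using a(1) by blast
    next
      assume "b \<preceq> a"
      then have "\<forall>t\<in>S. b \<preceq> t"
        using a(2) b(2) S(1) le_trans[of b a] by blast
      then show ?thesis
        using b(1) by blast
    qed
  qed
qed

text \<open>The elements with finitely many predecessors have a greatest one; an element above it would
  have a least successor, again with finitely many predecessors.\<close>

lemma finite_if_least_and_greatest: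
  assumes least: "well_ordered A"
    and greatest: "\<And>S. S \<subseteq> A \<Longrightarrow> S \<noteq> {} \<Longrightarrow> \<exists>s\<in>S. \<forall>t\<in>S. t \<preceq> s"
  shows "finite A"
proof (cases "A = {}")
  case False
  let ?below = "\<lambda>x. {y \<in> A. y \<preceq> x}"
  let ?T = "{x \<in> A. finite (?below x)}"
  obtain a where a: "a \<in> A" "\<forall>t\<in>A. a \<preceq> t"
    using obtain_least[OF least order_refl False] by blast
  then have "?below a = {a}"
    by (auto dest: le_antisym)
  then have "?T \<noteq> {}"
    using a(1) by (auto intro!: exI[of _ a])
  then obtain x where x: "x \<in> A" "finite (?below x)" and xmax: "\<And>t. t \<in> ?T \<Longrightarrow> t \<preceq> x"
    using greatest[of ?T] by blast
  have "A - ?below x = {}"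
  proof (rule ccontr)
    assume "A - ?below x \<noteq> {}"
    then obtain z where z: "z \<in> A" "\<not> z \<preceq> x" and zmin: "\<forall>t\<in>A - ?below x. z \<preceq> t"
      using obtain_least[OF least, of "A - ?below x"] by blast
    have "?below z \<subseteq> insert z (?below x)"
      using zmin by (auto dest: le_antisym)
    then have "z \<in> ?T"
      using z x by (auto intro: finite_subset)
    then show False
      using xmax z by blast
  qed
  then show ?thesis
    using x(2) by (metis (no_types, lifting) Diff_eq_empty_iff finite_subset)
qed auto

text \<open>In a product of two well-ordered sets, a set of pairs whose second components decrease
  strictly while the first ones increase is finite: its first components form a well-ordered set
  in which every non-empty subset also has a greatest element.\<close>

lemma finite_antichain:
  assumes A: "well_ordered A" "A \<subseteq> carrier G" and B: "well_ordered B" "B \<subseteq> carrier G"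
    and P: "P \<subseteq> A \<times> B"
    and anti: "\<And>a b a' b'. (a, b) \<in> P \<Longrightarrow> (a', b') \<in> P \<Longrightarrow> a' \<prec> a \<Longrightarrow> b \<prec> b'"
    and uniq: "\<And>a b b'. (a, b) \<in> P \<Longrightarrow> (a, b') \<in> P \<Longrightarrow> b = b'"
  shows "finite P"
proof -
  have "finite (fst ` P)"
  proof (rule finite_if_least_and_greatest)
    show "well_ordered (fst ` P)"
      using A(1) by (rule well_ordered_subset) (use P in auto)
    fix S assume S: "S \<subseteq> fst ` P" "S \<noteq> {}"
    let ?T = "{b. \<exists>a\<in>S. (a, b) \<in> P}"
    have "?T \<subseteq> B" "?T \<noteq> {}"
      using P S by force+
    then obtain b where b: "b \<in> ?T" and bmin: "\<forall>t\<in>?T. b \<preceq> t"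
      using obtain_least[OF B(1)] by blast
    then obtain a where a: "a \<in> S" "(a, b) \<in> P"
      by blast
    have "t \<preceq> a" if t: "t \<in> S" for t
    proof -
      obtain b' where b': "(t, b') \<in> P"
        using t S by force
      then have "\<not> b' \<prec> b"
        using bmin t not_less by blast
      then have "\<not> a \<prec> t"
        using anti[OF b' a(2)] by blast
      then show ?thesis
        using linear A(2) P b' a(2) by blast
    qed
    then show "\<exists>s\<in>S. \<forall>t\<in>S. t \<preceq> s"
      using a by blast
  qed
  moreover have "inj_on fst P"
    using uniq by (auto simp: inj_on_def)
  ultimately show ?thesis
    by (rule finite_imageD)
qed

lemma finite_factorisations:
  assumes "well_ordered A" "A \<subseteq> carrier G" "well_ordered B" "B \<subseteq> carrier G"
  shows "finite {(g, h). g \<in> A \<and> h \<in> B \<and> g \<otimes> h = t}"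
proof (rule finite_antichain[OF assms])
  fix a b a' b'
  assume "(a, b) \<in> {(g, h). g \<in> A \<and> h \<in> B \<and> g \<otimes> h = t}"
    "(a', b') \<in> {(g, h). g \<in> A \<and> h \<in> B \<and> g \<otimes> h = t}" "a' \<prec> a"
  then show "b \<prec> b'"
    using assms by (intro mult_eq_anti[of a a' b b']) auto
qed (use assms in \<open>auto simp: subset_iff\<close>)

text \<open>Every pair lies above a minimal one in the componentwise order, and the minimal pairs form
  a finite antichain; the least product is among theirs.\<close>

lemma well_ordered_products:
  assumes A: "well_ordered A" "A \<subseteq> carrier G" and B: "well_ordered B" "B \<subseteq> carrier G"
  shows "well_ordered {g \<otimes> h |g h. g \<in> A \<and> h \<in> B}"
  unfolding well_ordered_def
proof (intro allI impI, elim conjE)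
  fix S assume S: "S \<subseteq> {g \<otimes> h |g h. g \<in> A \<and> h \<in> B}" "S \<noteq> {}"
  define Q where "Q = {(a, b). a \<in> A \<and> b \<in> B \<and> a \<otimes> b \<in> S}"
  define M where "M = {(a, b). (a, b) \<in> Q \<and>
    (\<forall>x y. (x, y) \<in> Q \<longrightarrow> x \<preceq> a \<longrightarrow> y \<preceq> b \<longrightarrow> x = a \<and> y = b)}"
  have Q: "a \<in> A" "b \<in> B" "a \<otimes> b \<in> S" "a \<in> carrier G" "b \<in> carrier G" if "(a, b) \<in> Q" for a b
    using that A(2) B(2) by (auto simp: Q_def)
  have MQ: "(a, b) \<in> Q" if "(a, b) \<in> M" for a b
    using that by (simp add: M_def)
  have Mmin: "x = a \<and> y = b" if "(a, b) \<in> M" "(x, y) \<in> Q" "x \<preceq> a" "y \<preceq> b" for a b x y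
    using that by (simp add: M_def)
  have above: "\<exists>a' b'. (a', b') \<in> M \<and> a' \<preceq> a \<and> b' \<preceq> b" if ab: "(a, b) \<in> Q" for a b
  proof -
    define T where "T = {x. \<exists>y. (x, y) \<in> Q \<and> x \<preceq> a \<and> y \<preceq> b}"
    have "T \<subseteq> A" "T \<noteq> {}"
      using ab le_refl Q(1) unfolding T_def by blast+
    then obtain a' where a': "a' \<in> T" "\<forall>t\<in>T. a' \<preceq> t"
      by (rule obtain_least[OF A(1)])
    define U where "U = {y. (a', y) \<in> Q \<and> y \<preceq> b}"
    have "U \<subseteq> B" "U \<noteq> {}"
      using a'(1) Q(2) unfolding U_def T_def by blast+
    then obtain b' where b': "b' \<in> U" "\<forall>t\<in>U. b' \<preceq> t"
      by (rule obtain_least[OF B(1)])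
    have le: "a' \<preceq> a" "b' \<preceq> b" "(a', b') \<in> Q"
      using a'(1) b'(1) by (auto simp: T_def U_def)
    have "x = a' \<and> y = b'" if xy: "(x, y) \<in> Q" "x \<preceq> a'" "y \<preceq> b'" for x y
    proof -
      have "y \<preceq> b"
        using xy(3) le(2) by (rule le_trans)
      moreover have "x \<preceq> a"
        using xy(2) le(1) by (rule le_trans)
      ultimately have "x \<in> T"
        using xy(1) by (auto simp: T_def)
      then have x: "x = a'"
        using a'(2) xy(2) le_antisym by blast
      have "y \<in> U"
        using xy(1) x \<open>y \<preceq> b\<close> by (simp add: U_def)
      then show ?thesis
        using x b'(2) xy(3) le_antisym by blast
    qed
    then have "(a', b') \<in> M"
      using le(3) by (simp add: M_def)
    then show ?thesis
      using le by blast
  qed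
  have "finite M"
  proof (rule finite_antichain[OF A B])
    show "M \<subseteq> A \<times> B"
      by (auto dest!: MQ intro: Q(1,2))
  next
    fix a b a' b' assume *: "(a, b) \<in> M" "(a', b') \<in> M" "a' \<prec> a"
    have "\<not> b' \<preceq> b"
      using Mmin[OF *(1) MQ[OF *(2)] less_imp_le[OF *(3)]] *(3) irrefl by blast
    then show "b \<prec> b'"
      using linear[of b' b] Q(5) MQ * by blast
  next
    fix a b b' assume *: "(a, b) \<in> M" "(a, b') \<in> M"
    have "b \<preceq> b' \<or> b' \<preceq> b"
      using linear[of b b'] Q(5) MQ * less_imp_le by blast
    then show "b = b'"
      using Mmin[OF *(1) MQ[OF *(2)]] Mmin[OF *(2) MQ[OF *(1)]] by auto
  qed
  define N where "N = (\<lambda>(a, b). a \<otimes> b) ` M"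
  have fin: "finite N"
    using \<open>finite M\<close> by (simp add: N_def)
  have NS: "N \<subseteq> S"
    by (auto simp: N_def dest!: MQ intro: Q(3))
  have carr: "N \<subseteq> carrier G"
    by (auto simp: N_def dest!: MQ intro!: m_closed intro: Q(4,5))
  have N_below: "\<exists>x\<in>N. x \<preceq> t" if t: "t \<in> S" for t
  proof -
    obtain a b where "a \<in> A" "b \<in> B" and tab: "t = a \<otimes> b"
      using t S(1) by blast
    then have ab: "(a, b) \<in> Q"
      using t by (simp add: Q_def)
    then obtain a' b' where *: "(a', b') \<in> M" "a' \<preceq> a" "b' \<preceq> b"
      using above by blast
    then have "a' \<otimes> b' \<preceq> t"
      unfolding tab using Q[OF ab] Q[OF MQ[OF *(1)]] *(2,3) by (intro mult_mono)
    moreover have "a' \<otimes> b' \<in> N"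
      using *(1) by (force simp: N_def)
    ultimately show ?thesis
      by blast
  qed
  have "N \<noteq> {}"
    using S N_below by blast
  moreover have "asymp_on N (\<prec>)"
    by (rule asymp_onI) (use irrefl trans in blast)
  moreover have "transp_on N (\<prec>)"
    by (rule transp_onI) (rule trans)
  moreover have "totalp_on N (\<prec>)"
    by (rule totalp_onI) (use total carr in blast)
  ultimately obtain s where s: "s \<in> N" "\<forall>t\<in>N. t \<noteq> s \<longrightarrow> s \<prec> t"
    using Finite_Set.bex_least_element[OF fin] by blast
  have "s \<preceq> t" if t: "t \<in> S" for t
  proof -
    obtain x where x: "x \<in> N" "x \<preceq> t"
      using N_below[OF t] by blast
    then have "s \<preceq> x"
      using s(2) by (auto simp: le_def)
    then show ?thesis
      using x(2) by (rule le_trans)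
  qed
  moreover have "s \<in> S"
    using s(1) NS by blast
  ultimately show "\<exists>s\<in>S. \<forall>t\<in>S. s \<preceq> t"
    by blast
qed

end

section \<open>The dictionary order\<close>

lemma mono_before_trans: "(a, b) \<in> mono_before \<Longrightarrow> (b, c) \<in> mono_before \<Longrightarrow> (a, c) \<in> mono_before"
  unfolding mono_before_def by (erule lenlex_trans) (auto intro: transI)

lemma mono_before_irrefl: "(a, a) \<notin> mono_before"
  unfolding mono_before_def by (rule lenlex_irreflexive) auto

lemma mono_before_total: "a \<noteq> b \<Longrightarrow> (a, b) \<in> mono_before \<or> (b, a) \<in> mono_before"
proof -
  have "total mono_before"
    unfolding mono_before_def by (rule total_lenlex) (auto simp: total_on_def)
  then show "a \<noteq> b \<Longrightarrow> (a, b) \<in> mono_before \<or> (b, a) \<in> mono_before"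
    by (simp add: total_on_def)
qed

lemma mono_before_shorter: "length a < length b \<Longrightarrow> (a, b) \<in> mono_before"
  by (auto simp: mono_before_def lenlex_conv)

lemma mono_before_length: "(a, b) \<in> mono_before \<Longrightarrow> length a \<le> length b"
  unfolding mono_before_def by (rule lenlex_length)

text \<open>The first nonzero coefficient of the series is positive.\<close>

definition first_positive :: "ncseries \<Rightarrow> bool" where
  "first_positive d \<longleftrightarrow> (\<exists>m. d m > 0 \<and> (\<forall>m'. (m', m) \<in> mono_before \<longrightarrow> d m' = 0))"

lemma dict_less_iff: "dict_less g h \<longleftrightarrow> first_positive (\<lambda>m. magnus h m - magnus g m)"
  by (simp add: dict_less_def first_positive_def)

lemma first_positive_add:
  assumes "first_positive d" "first_positive e"
  shows "first_positive (\<lambda>m. d m + e m)"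
proof -
  obtain a where a: "d a > 0" "\<And>m. (m, a) \<in> mono_before \<Longrightarrow> d m = 0"
    using assms(1) by (auto simp: first_positive_def)
  obtain b where b: "e b > 0" "\<And>m. (m, b) \<in> mono_before \<Longrightarrow> e m = 0"
    using assms(2) by (auto simp: first_positive_def)
  consider "a = b" | "(a, b) \<in> mono_before" | "(b, a) \<in> mono_before"
    using mono_before_total by blast
  then show ?thesis
  proof cases
    case 1
    then show ?thesis
      using a b by (auto simp: first_positive_def intro!: exI[of _ a])
  next
    case 2
    then show ?thesis
      using a b mono_before_trans by (auto simp: first_positive_def intro!: exI[of _ a])
  next
    case 3
    then show ?thesis
      using a b mono_before_trans by (auto simp: first_positive_def intro!: exI[of _ b])
  qed
qed

text \<open>A factor with constant term \<open>1\<close> keeps the first term of a series.\<close>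

lemma ncs_mult_first_left:
  assumes "f [] = 1" "\<And>m'. (m', m) \<in> mono_before \<Longrightarrow> d m' = 0"
  shows "ncs_mult f d m = d m"
proof -
  have "ncs_mult f d m = (\<Sum>k\<le>length m. if k = 0 then d m else 0)"
    unfolding ncs_mult_def
    using assms by (intro sum.cong) (auto simp: mono_before_shorter)
  then show ?thesis
    by simp
qed

lemma ncs_mult_first_right:
  assumes "f [] = 1" "\<And>m'. (m', m) \<in> mono_before \<Longrightarrow> d m' = 0"
  shows "ncs_mult d f m = d m"
proof -
  have "ncs_mult d f m = (\<Sum>k\<le>length m. if k = length m then d m else 0)"
    unfolding ncs_mult_def
    using assms by (intro sum.cong) (auto simp: mono_before_shorter)
  then show ?thesis
    by simp
qed

text \<open>As the images of group elements have constant term \<open>1\<close>, the order is invariant under left and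
  right multiplication.\<close>

lemma first_positive_mult:
  assumes "first_positive d" "f [] = 1"
  shows "first_positive (ncs_mult f d)" "first_positive (ncs_mult d f)"
proof -
  obtain m where m: "d m > 0" "\<And>m'. (m', m) \<in> mono_before \<Longrightarrow> d m' = 0"
    using assms(1) by (auto simp: first_positive_def)
  have "d m'' = 0" if "(m', m) \<in> mono_before" "(m'', m') \<in> mono_before" for m' m''
    using that m mono_before_trans by blast
  then show "first_positive (ncs_mult f d)" "first_positive (ncs_mult d f)"
    using m assms(2) unfolding first_positive_def
    by (auto simp: ncs_mult_first_left ncs_mult_first_right intro!: exI[of _ m])
qed

lemma ncs_mult_diff_right: "ncs_mult f (\<lambda>m. g m - h m) = (\<lambda>m. ncs_mult f g m - ncs_mult f h m)"
  by (simp add: ncs_mult_def fun_eq_iff right_diff_distrib sum_subtractf)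

lemma ncs_mult_diff_left: "ncs_mult (\<lambda>m. g m - h m) f = (\<lambda>m. ncs_mult g f m - ncs_mult h f m)"
  by (simp add: ncs_mult_def fun_eq_iff left_diff_distrib sum_subtractf)

text \<open>Only the finitely many variables of \<open>g\<close> and \<open>h\<close> matter, so among the monomials on which the
  two series differ there is a first one.\<close>

lemma dict_less_total:
  assumes "reduced g" "reduced h" "g \<noteq> h"
  shows "dict_less g h \<or> dict_less h g"
proof -
  let ?d = "\<lambda>m. magnus h m - magnus g m"
  obtain m0 where m0: "?d m0 \<noteq> 0"
    using magnus_inj[OF assms(1,2)] assms(3) by fastforce
  let ?V = "fst ` set g \<union> fst ` set h"
  define M where "M = {m. ?d m \<noteq> 0 \<and> length m \<le> length m0}"
  have "set m \<subseteq> ?V" if "?d m \<noteq> 0" for m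
  proof -
    have "magnus g m \<noteq> 0 \<or> magnus h m \<noteq> 0"
      using that by auto
    then show ?thesis
      using magnus_support by blast
  qed
  then have "M \<subseteq> {m. set m \<subseteq> ?V \<and> length m \<le> length m0}"
    by (auto simp: M_def)
  then have fin: "finite M"
    by (rule finite_subset) (simp add: finite_lists_length_le)
  have ne: "M \<noteq> {}"
    using m0 by (auto simp: M_def)
  have "asymp_on M (\<lambda>a b. (a, b) \<in> mono_before)"
    by (rule asymp_onI) (use mono_before_irrefl mono_before_trans in blast)
  moreover have "transp_on M (\<lambda>a b. (a, b) \<in> mono_before)"
    by (rule transp_onI) (rule mono_before_trans)
  ultimately obtain m where m: "m \<in> M" "\<forall>m'\<in>M. m' \<noteq> m \<longrightarrow> (m', m) \<notin> mono_before"
    using Finite_Set.bex_min_element[OF fin _ _ ne] by blast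
  have before: "?d m' = 0" if "(m', m) \<in> mono_before" for m'
  proof (rule ccontr)
    assume "?d m' \<noteq> 0"
    then have "m' \<in> M"
      using m(1) mono_before_length[OF that] by (auto simp: M_def)
    moreover have "m' \<noteq> m"
      using that mono_before_irrefl by blast
    ultimately show False
      using m(2) that by blast
  qed
  show ?thesis
  proof (cases "?d m > 0")
    case True
    then show ?thesis
      using before unfolding dict_less_def by blast
  next
    case False
    then have "magnus g m - magnus h m > 0"
      using m(1) by (auto simp: M_def)
    then show ?thesis
      using before unfolding dict_less_def by force
  qed
qed

lemma ordered_group_free_grp: "ordered_group free_grp dict_less"
proof -
  interpret group free_grp
    by (rule group_free_grp)
  show ?thesis
  proof
    show "\<not> dict_less g g" for g
      by (simp add: dict_less_def)
    show "dict_less g k" if "dict_less g h" "dict_less h k" for g h k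
      using first_positive_add[OF that[unfolded dict_less_iff]] by (simp add: dict_less_iff)
    show "dict_less g h \<or> dict_less h g"
      if "g \<in> carrier free_grp" "h \<in> carrier free_grp" "g \<noteq> h" for g h
      using that dict_less_total by (simp add: carrier_free_grp)
    show "dict_less (k \<otimes>\<^bsub>free_grp\<^esub> g) (k \<otimes>\<^bsub>free_grp\<^esub> h)"
      "dict_less (g \<otimes>\<^bsub>free_grp\<^esub> k) (h \<otimes>\<^bsub>free_grp\<^esub> k)" if "dict_less g h" for g h k
      using first_positive_mult[of "\<lambda>m. magnus h m - magnus g m" "magnus k"] that
      by (simp_all add: dict_less_iff mult_free_grp magnus_mult
          ncs_mult_diff_left ncs_mult_diff_right)
  qed
qed

section \<open>Twisted series with well-ordered support\<close>

text \<open>An ordered group that acts on a division ring by ring homomorphisms, which are then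
  automorphisms. The ordered group is arbitrary here.\<close>

locale twisted_series = ordered_group G less
  for G :: "('g, 'b) monoid_scheme" (structure) and less :: "'g \<Rightarrow> 'g \<Rightarrow> bool"  (infix \<open>\<prec>\<close> 50) +
  fixes \<Phi> :: "'g \<Rightarrow> 'k::division_ring \<Rightarrow> 'k"
  assumes act_add: "g \<in> carrier G \<Longrightarrow> \<Phi> g (a + b) = \<Phi> g a + \<Phi> g b"
    and act_mult: "g \<in> carrier G \<Longrightarrow> \<Phi> g (a * b) = \<Phi> g a * \<Phi> g b"
    and act_unit: "g \<in> carrier G \<Longrightarrow> \<Phi> g 1 = 1"
    and act_comp: "g \<in> carrier G \<Longrightarrow> h \<in> carrier G \<Longrightarrow> \<Phi> (g \<otimes> h) a = \<Phi> g (\<Phi> h a)"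
    and act_id: "\<Phi> \<one> a = a"
begin

lemma act_zero [simp]: "g \<in> carrier G \<Longrightarrow> \<Phi> g 0 = 0"
  using act_add[of g 0 0] by simp

lemma act_diff: "g \<in> carrier G \<Longrightarrow> \<Phi> g (a - b) = \<Phi> g a - \<Phi> g b"
  using act_add[of g "a - b" b] by simp

lemma act_sum: "g \<in> carrier G \<Longrightarrow> \<Phi> g (sum f A) = (\<Sum>x\<in>A. \<Phi> g (f x))"
  by (induction A rule: infinite_finite_induct) (simp_all add: act_add)

lemma act_inv: "g \<in> carrier G \<Longrightarrow> \<Phi> g (\<Phi> (inv g) a) = a"
  by (metis act_comp act_id inv_closed r_inv)

lemma act_eq_0_iff [simp]: "g \<in> carrier G \<Longrightarrow> \<Phi> g a = 0 \<longleftrightarrow> a = 0"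
  by (metis act_comp act_id act_zero inv_closed l_inv)

abbreviation spt :: "('g \<Rightarrow> 'k) \<Rightarrow> 'g set" where
  "spt \<alpha> \<equiv> {g. \<alpha> g \<noteq> 0}"

text \<open>Series are coefficient functions that vanish off the carrier.\<close>

definition series :: "('g \<Rightarrow> 'k) set" where
  "series = {\<alpha>. spt \<alpha> \<subseteq> carrier G \<and> well_ordered (spt \<alpha>)}"

text \<open>The twisted product. It is meaningful for series only: for them the sum is finite, by
  \<open>finite_spt_factorisations\<close> below.\<close>

definition conv :: "('g \<Rightarrow> 'k) \<Rightarrow> ('g \<Rightarrow> 'k) \<Rightarrow> 'g \<Rightarrow> 'k" where
  "conv \<alpha> \<beta> t = (\<Sum>(g, h) \<in> {(g, h). g \<in> spt \<alpha> \<and> h \<in> spt \<beta> \<and> g \<otimes> h = t}. \<alpha> g * \<Phi> g (\<beta> h))"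

definition unit_series :: "'g \<Rightarrow> 'k" where
  "unit_series g = (if g = \<one> then 1 else 0)"

lemma spt_carrier: "\<alpha> \<in> series \<Longrightarrow> \<alpha> g \<noteq> 0 \<Longrightarrow> g \<in> carrier G"
  by (auto simp: series_def)

lemma series_wo: "\<alpha> \<in> series \<Longrightarrow> well_ordered (spt \<alpha>)"
  by (simp add: series_def)

lemma series_carrier: "\<alpha> \<in> series \<Longrightarrow> spt \<alpha> \<subseteq> carrier G"
  by (simp add: series_def)

lemma finite_spt_factorisations:
  assumes "\<alpha> \<in> series" "\<beta> \<in> series"
  shows "finite {(g, h). g \<in> spt \<alpha> \<and> h \<in> spt \<beta> \<and> g \<otimes> h = t}"
  using assms by (intro finite_factorisations) (simp_all add: series_wo series_carrier)

text \<open>A product coefficient may be summed over any larger finite set of factorisations.\<close>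

lemma conv_eq_sum:
  assumes "finite P" "P \<subseteq> {(g, h). g \<in> carrier G \<and> h \<in> carrier G \<and> g \<otimes> h = t}"
    and "{(g, h). g \<in> spt \<alpha> \<and> h \<in> spt \<beta> \<and> g \<otimes> h = t} \<subseteq> P"
  shows "conv \<alpha> \<beta> t = (\<Sum>(g, h) \<in> P. \<alpha> g * \<Phi> g (\<beta> h))"
  unfolding conv_def
  by (rule sum.mono_neutral_left) (use assms in auto)

lemma zero_series: "(\<lambda>g. 0) \<in> series"
  by (simp add: series_def well_ordered_def)

lemma unit_series_closed: "unit_series \<in> series"
proof -
  have "spt unit_series = {\<one>}"
    by (auto simp: unit_series_def)
  then show ?thesis
    by (auto simp: series_def well_ordered_def subset_singleton_iff)
qed

lemma unit_series_nonzero: "unit_series \<noteq> (\<lambda>g. 0)"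
  by (auto simp: unit_series_def fun_eq_iff)

lemma spt_conv: "spt (conv \<alpha> \<beta>) \<subseteq> {g \<otimes> h |g h. g \<in> spt \<alpha> \<and> h \<in> spt \<beta>}"
proof
  fix t assume t: "t \<in> spt (conv \<alpha> \<beta>)"
  have "{(g, h). g \<in> spt \<alpha> \<and> h \<in> spt \<beta> \<and> g \<otimes> h = t} \<noteq> {}"
  proof
    assume "{(g, h). g \<in> spt \<alpha> \<and> h \<in> spt \<beta> \<and> g \<otimes> h = t} = {}"
    then have "conv \<alpha> \<beta> t = 0"
      unfolding conv_def by (simp only: sum.empty)
    then show False
      using t by simp
  qed
  then show "t \<in> {g \<otimes> h |g h. g \<in> spt \<alpha> \<and> h \<in> spt \<beta>}"
    by blast
qed

lemma conv_closed:
  assumes "\<alpha> \<in> series" "\<beta> \<in> series"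
  shows "conv \<alpha> \<beta> \<in> series"
proof -
  have "well_ordered {g \<otimes> h |g h. g \<in> spt \<alpha> \<and> h \<in> spt \<beta>}"
    using assms by (intro well_ordered_products) (simp_all add: series_wo series_carrier)
  then have "well_ordered (spt (conv \<alpha> \<beta>))"
    using spt_conv by (rule well_ordered_subset)
  moreover have "spt (conv \<alpha> \<beta>) \<subseteq> carrier G"
    using spt_conv[of \<alpha> \<beta>] assms spt_carrier by fastforce
  ultimately show ?thesis
    by (simp add: series_def)
qed

lemma conv_outside:
  assumes "\<alpha> \<in> series" "\<beta> \<in> series" "t \<notin> carrier G"
  shows "conv \<alpha> \<beta> t = 0"
  using conv_closed[OF assms(1,2)] assms(3) spt_carrier by blast

text \<open>Both sides are sums over the factorisations of \<open>t\<close> into three factors from the supports,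
  grouped in two ways.\<close>

lemma conv_assoc:
  assumes "\<alpha> \<in> series" "\<beta> \<in> series" "\<gamma> \<in> series"
  shows "conv (conv \<alpha> \<beta>) \<gamma> = conv \<alpha> (conv \<beta> \<gamma>)"
proof
  fix t
  show "conv (conv \<alpha> \<beta>) \<gamma> t = conv \<alpha> (conv \<beta> \<gamma>) t"
  proof -
    note carr = assms[THEN series_carrier]
    note wo = assms[THEN series_wo]
    note c = spt_carrier[OF assms(1)] spt_carrier[OF assms(2)] spt_carrier[OF assms(3)]
    let ?U = "{g \<otimes> h |g h. g \<in> spt \<alpha> \<and> h \<in> spt \<beta>}"
    let ?V = "{h \<otimes> k |h k. h \<in> spt \<beta> \<and> k \<in> spt \<gamma>}"
    let ?L = "{(u, k). u \<in> ?U \<and> k \<in> spt \<gamma> \<and> u \<otimes> k = t}"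
    let ?R = "{(g, v). g \<in> spt \<alpha> \<and> v \<in> ?V \<and> g \<otimes> v = t}"
    let ?l = "\<lambda>(u, k :: 'g). {(g, h). g \<in> spt \<alpha> \<and> h \<in> spt \<beta> \<and> g \<otimes> h = u}"
    let ?r = "\<lambda>(g :: 'g, v). {(h, k). h \<in> spt \<beta> \<and> k \<in> spt \<gamma> \<and> h \<otimes> k = v}"
    have U: "well_ordered ?U" "?U \<subseteq> carrier G"
      using well_ordered_products[OF wo(1) carr(1) wo(2) carr(2)] carr by auto
    have V: "well_ordered ?V" "?V \<subseteq> carrier G"
      using well_ordered_products[OF wo(2) carr(2) wo(3) carr(3)] carr by auto
    have L: "finite ?L"
      by (rule finite_factorisations[OF U wo(3) carr(3)])
    have R: "finite ?R"
      by (rule finite_factorisations[OF wo(1) carr(1) V])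
    have l: "\<forall>x\<in>?L. finite (?l x)" and r: "\<forall>x\<in>?R. finite (?r x)"
      using assms finite_spt_factorisations by auto
    have "conv (conv \<alpha> \<beta>) \<gamma> t = (\<Sum>(u, k)\<in>?L. conv \<alpha> \<beta> u * \<Phi> u (\<gamma> k))"
      using spt_conv[of \<alpha> \<beta>] U carr by (intro conv_eq_sum L) auto
    also have "\<dots> = (\<Sum>x\<in>?L. \<Sum>y\<in>?l x. \<alpha> (fst y) * \<Phi> (fst y) (\<beta> (snd y)) * \<Phi> (fst x) (\<gamma> (snd x)))"
      by (intro sum.cong) (auto simp: conv_def sum_distrib_right case_prod_unfold)
    also have "\<dots> = (\<Sum>(x, y)\<in>Sigma ?L ?l.
        \<alpha> (fst y) * \<Phi> (fst y) (\<beta> (snd y)) * \<Phi> (fst x) (\<gamma> (snd x)))"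
      by (rule sum.Sigma[OF L l])
    also have "\<dots> = (\<Sum>(x, y)\<in>Sigma ?R ?r.
        \<alpha> (fst x) * (\<Phi> (fst x) (\<beta> (fst y) * \<Phi> (fst y) (\<gamma> (snd y)))))"
    proof (rule sum.reindex_bij_witness
        [of _ "\<lambda>((g, v), (h, k)). ((g \<otimes> h, k), (g, h))" "\<lambda>((u, k), (g, h)). ((g, h \<otimes> k), (h, k))"],
        goal_cases)
      case (1 x)
      then show ?case by auto
    next
      case (2 x)
      then show ?case using c by (auto simp: m_assoc[symmetric])
    next
      case (3 x)
      then show ?case by auto
    next
      case (4 x)
      then show ?case using c by (auto simp: m_assoc)
    next
      case (5 x)
      then show ?case using c by (auto simp: act_mult act_comp[symmetric] mult.assoc)
    qed
    also have "\<dots> = (\<Sum>x\<in>?R. \<Sum>y\<in>?r x. \<alpha> (fst x) * (\<Phi> (fst x) (\<beta> (fst y) * \<Phi> (fst y) (\<gamma> (snd y)))))"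
      by (rule sum.Sigma[OF R r, symmetric])
    also have "\<dots> = (\<Sum>(g, v)\<in>?R. \<alpha> g * \<Phi> g (conv \<beta> \<gamma> v))"
      using carr by (intro sum.cong)
        (auto simp: conv_def sum_distrib_left case_prod_unfold act_sum subset_iff)
    also have "\<dots> = conv \<alpha> (conv \<beta> \<gamma>) t"
      using spt_conv[of \<beta> \<gamma>] V carr by (intro conv_eq_sum[symmetric] R) auto
    finally show ?thesis .
  qed
qed

lemma conv_unit_left:
  assumes "\<alpha> \<in> series"
  shows "conv unit_series \<alpha> = \<alpha>"
proof
  fix t
  show "conv unit_series \<alpha> t = \<alpha> t"
  proof (cases "t \<in> carrier G")
    case True
    have "conv unit_series \<alpha> t = (\<Sum>(g, h) \<in> {(\<one>, t)}. unit_series g * \<Phi> g (\<alpha> h))"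
      using True assms spt_carrier by (intro conv_eq_sum) (auto simp: unit_series_def split: if_splits)
    then show ?thesis
      by (simp add: unit_series_def act_id)
  next
    case False
    then show ?thesis
      using conv_outside[OF unit_series_closed assms] assms spt_carrier by metis
  qed
qed

lemma conv_unit_right:
  assumes "\<alpha> \<in> series"
  shows "conv \<alpha> unit_series = \<alpha>"
proof
  fix t
  show "conv \<alpha> unit_series t = \<alpha> t"
  proof (cases "t \<in> carrier G")
    case True
    have "conv \<alpha> unit_series t = (\<Sum>(g, h) \<in> {(t, \<one>)}. \<alpha> g * \<Phi> g (unit_series h))"
      using True assms spt_carrier by (intro conv_eq_sum) (auto simp: unit_series_def split: if_splits)
    then show ?thesis
      using True by (simp add: unit_series_def act_unit)
  next
    case False
    then show ?thesis
      using conv_outside[OF assms unit_series_closed] assms spt_carrier by metis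
  qed
qed

text \<open>\<open>g\<close> is the least element of the support of \<open>\<alpha>\<close>.\<close>

definition leads :: "('g \<Rightarrow> 'k) \<Rightarrow> 'g \<Rightarrow> bool" where
  "leads \<alpha> g \<longleftrightarrow> \<alpha> g \<noteq> 0 \<and> (\<forall>h. \<alpha> h \<noteq> 0 \<longrightarrow> g \<preceq> h)"

lemma leads_exists:
  assumes "\<alpha> \<in> series" "\<alpha> \<noteq> (\<lambda>g. 0)"
  shows "\<exists>g. leads \<alpha> g"
proof -
  have "spt \<alpha> \<noteq> {}"
    using assms(2) by auto
  then obtain g where "g \<in> spt \<alpha>" "\<forall>h\<in>spt \<alpha>. g \<preceq> h"
    by (rule obtain_least[OF series_wo[OF assms(1)] order_refl])
  then show ?thesis
    by (auto simp: leads_def)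
qed

lemma leads_unique: "leads \<alpha> g \<Longrightarrow> leads \<alpha> h \<Longrightarrow> g = h"
  unfolding leads_def using le_antisym by blast

text \<open>The first coefficient at which two right factors differ decides the first coefficient at
  which the products differ.\<close>

lemma conv_diff:
  assumes \<alpha>: "\<alpha> \<in> series" "leads \<alpha> a" and \<gamma>: "\<gamma> \<in> series" "\<gamma>' \<in> series"
    and h: "h \<in> carrier G" and eq: "\<And>x. x \<prec> h \<Longrightarrow> \<gamma> x = \<gamma>' x"
  shows "conv \<alpha> \<gamma> (a \<otimes> h) - conv \<alpha> \<gamma>' (a \<otimes> h) = \<alpha> a * \<Phi> a (\<gamma> h - \<gamma>' h)"
proof -
  have a: "a \<in> carrier G" "\<And>x. \<alpha> x \<noteq> 0 \<Longrightarrow> a \<preceq> x"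
    using \<alpha> spt_carrier by (auto simp: leads_def)
  define F where "F \<delta> = {(x, y). x \<in> spt \<alpha> \<and> y \<in> spt \<delta> \<and> x \<otimes> y = a \<otimes> h}" for \<delta>
  define P where "P = insert (a, h) (F \<gamma> \<union> F \<gamma>')"
  have F: "finite (F \<delta>)" if "\<delta> \<in> series" for \<delta>
    unfolding F_def by (rule finite_spt_factorisations[OF \<alpha>(1) that])
  then have fin: "finite P"
    using \<gamma> by (simp add: P_def)
  have P: "x \<in> carrier G" "y \<in> carrier G" "x \<otimes> y = a \<otimes> h" "a \<preceq> x" if "(x, y) \<in> P" for x y
  proof -
    have *: "y \<in> carrier G" if "(x, y) \<in> F \<delta>" "\<delta> \<in> series" for \<delta>
      using that spt_carrier[OF that(2), of y] by (simp add: F_def)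
    have "x = a \<and> y = h \<or> \<alpha> x \<noteq> 0 \<and> x \<otimes> y = a \<otimes> h \<and> y \<in> carrier G"
      using that *[of \<gamma>] *[of \<gamma>'] \<gamma> by (auto simp: P_def F_def)
    then show "x \<in> carrier G" "y \<in> carrier G" "x \<otimes> y = a \<otimes> h" "a \<preceq> x"
      using a h spt_carrier[OF \<alpha>(1), of x] by auto
  qed
  have other: "\<gamma> y = \<gamma>' y" if xy: "(x, y) \<in> P" "(x, y) \<noteq> (a, h)" for x y
  proof -
    note c = P[OF xy(1)]
    have "x \<noteq> a"
    proof
      assume x: "x = a"
      then have "y = h"
        using c(2,3) a(1) h by simp
      then show False
        using x xy(2) by simp
    qed
    then have "a \<prec> x"
      using c(4) by (auto simp: le_def)
    then have "y \<prec> h"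
      using mult_eq_anti[of x a y h] c a(1) h by simp
    then show ?thesis
      by (rule eq)
  qed
  have sub: "P \<subseteq> {(x, y). x \<in> carrier G \<and> y \<in> carrier G \<and> x \<otimes> y = a \<otimes> h}"
    by (auto intro: P(1,2) dest: P(3))
  have "conv \<alpha> \<gamma> (a \<otimes> h) = (\<Sum>(x, y)\<in>P. \<alpha> x * \<Phi> x (\<gamma> y))"
    by (rule conv_eq_sum[OF fin sub]) (auto simp: P_def F_def)
  moreover have "conv \<alpha> \<gamma>' (a \<otimes> h) = (\<Sum>(x, y)\<in>P. \<alpha> x * \<Phi> x (\<gamma>' y))"
    by (rule conv_eq_sum[OF fin sub]) (auto simp: P_def F_def)
  moreover have "(\<Sum>(x, y)\<in>P. \<alpha> x * \<Phi> x (\<gamma> y)) - (\<Sum>(x, y)\<in>P. \<alpha> x * \<Phi> x (\<gamma>' y)) =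
      (\<Sum>(x, y)\<in>P. \<alpha> x * \<Phi> x (\<gamma> y - \<gamma>' y))"
    unfolding sum_subtractf[symmetric]
    by (intro sum.cong refl) (auto simp: act_diff P(1) right_diff_distrib)
  moreover have "(\<Sum>(x, y)\<in>P. \<alpha> x * \<Phi> x (\<gamma> y - \<gamma>' y)) =
      (\<Sum>z\<in>P. if z = (a, h) then \<alpha> a * \<Phi> a (\<gamma> h - \<gamma>' h) else 0)"
  proof (rule sum.cong[OF refl])
    fix z assume z: "z \<in> P"
    obtain x y where xy: "z = (x, y)"
      by fastforce
    have "x \<in> carrier G"
      using P(1) z xy by blast
    then show "(case z of (x, y) \<Rightarrow> \<alpha> x * \<Phi> x (\<gamma> y - \<gamma>' y)) =
        (if z = (a, h) then \<alpha> a * \<Phi> a (\<gamma> h - \<gamma>' h) else 0)"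
      using other[of x y] z by (cases "(x, y) = (a, h)") (auto simp: xy)
  qed
  moreover have "(a, h) \<in> P"
    by (simp add: P_def)
  ultimately show ?thesis
    using fin by simp
qed

lemma conv_cong:
  assumes "\<alpha> \<in> series" "leads \<alpha> a" "\<gamma> \<in> series" "\<gamma>' \<in> series" "h \<in> carrier G"
    and "\<And>x. x \<preceq> h \<Longrightarrow> \<gamma> x = \<gamma>' x"
  shows "conv \<alpha> \<gamma> (a \<otimes> h) = conv \<alpha> \<gamma>' (a \<otimes> h)"
proof -
  have "a \<in> carrier G"
    using assms spt_carrier by (auto simp: leads_def)
  then show ?thesis
    using conv_diff[OF assms(1-5)] assms(6) less_imp_le by auto
qed

lemma leads_conv:
  assumes \<alpha>: "\<alpha> \<in> series" "leads \<alpha> a" and \<beta>: "\<beta> \<in> series" "leads \<beta> b"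
  shows "leads (conv \<alpha> \<beta>) (a \<otimes> b)"
proof -
  have c: "a \<in> carrier G" "b \<in> carrier G"
    using assms spt_carrier by (auto simp: leads_def)
  have conv0: "conv \<alpha> (\<lambda>g. 0) t = 0" for t
    by (simp add: conv_def)
  have below: "\<beta> x = 0" if "x \<prec> b" for x
    using \<beta> that not_less unfolding leads_def by blast
  have "conv \<alpha> \<beta> (a \<otimes> b) = \<alpha> a * \<Phi> a (\<beta> b)"
    using conv_diff[OF \<alpha> \<beta>(1) zero_series c(2)] below by (simp add: conv0)
  moreover have "a \<otimes> b \<preceq> t" if t: "conv \<alpha> \<beta> t \<noteq> 0" for t
  proof -
    obtain g h where *: "t = g \<otimes> h" "g \<in> spt \<alpha>" "h \<in> spt \<beta>"
      using spt_conv[of \<alpha> \<beta>] t by blast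
    then show ?thesis
      using assms c spt_carrier by (auto simp: leads_def intro!: mult_mono)
  qed
  ultimately show ?thesis
    using assms c by (auto simp: leads_def)
qed

text \<open>The inverse is built from its initial pieces. A partial inverse is a series whose product
  with \<open>\<alpha>\<close> agrees with the unit series as far as its own support reaches. Partial inverses agree
  with each other, so they glue to a largest one; were its product with \<open>\<alpha>\<close> not the unit series,
  one further term would correct the first wrong coefficient.\<close>

lemma right_inverse_exists:
  assumes \<alpha>: "\<alpha> \<in> series" "\<alpha> \<noteq> (\<lambda>g. 0)"
  shows "\<exists>\<gamma>\<in>series. conv \<alpha> \<gamma> = unit_series"
proof -
  obtain a where a: "leads \<alpha> a"
    using leads_exists[OF \<alpha>] by blast
  then have aG: "a \<in> carrier G" and a0: "\<alpha> a \<noteq> 0"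
    using \<alpha> spt_carrier by (auto simp: leads_def)
  define P where "P = {\<gamma> \<in> series. \<forall>s\<in>spt \<gamma>. \<forall>t\<in>carrier G. t \<preceq> s \<longrightarrow>
    conv \<alpha> \<gamma> (a \<otimes> t) = unit_series (a \<otimes> t)}"
  have PD: "\<gamma> \<in> series" "\<gamma> s \<noteq> 0 \<Longrightarrow> t \<in> carrier G \<Longrightarrow> t \<preceq> s \<Longrightarrow>
    conv \<alpha> \<gamma> (a \<otimes> t) = unit_series (a \<otimes> t)" if "\<gamma> \<in> P" for \<gamma> s t
    using that by (auto simp: P_def)
  have agree: "\<gamma> t = \<gamma>' t"
    if P: "\<gamma> \<in> P" "\<gamma>' \<in> P" and s: "\<gamma> s \<noteq> 0" "\<gamma>' s' \<noteq> 0" and t: "t \<preceq> s" "t \<preceq> s'" for \<gamma> \<gamma>' s s' t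
  proof (rule ccontr)
    assume neq: "\<gamma> t \<noteq> \<gamma>' t"
    define D where "D = {x. \<gamma> x \<noteq> \<gamma>' x \<and> x \<preceq> t}"
    have sub: "D \<subseteq> spt \<gamma> \<union> spt \<gamma>'"
      by (auto simp: D_def)
    have ne: "D \<noteq> {}"
      using neq le_refl by (auto simp: D_def)
    have "well_ordered (spt \<gamma> \<union> spt \<gamma>')"
      using P PD(1) by (intro well_ordered_Un) (simp_all add: series_wo series_carrier)
    then obtain x where x: "x \<in> D" "\<forall>y\<in>D. x \<preceq> y"
      using sub ne by (rule obtain_least)
    have xD: "\<gamma> x \<noteq> \<gamma>' x" "x \<preceq> t"
      using x(1) by (simp_all add: D_def)
    have xG: "x \<in> carrier G"
      using xD(1) spt_carrier[OF PD(1)[OF P(1)]] spt_carrier[OF PD(1)[OF P(2)]] by metis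
    have below: "\<gamma> y = \<gamma>' y" if "y \<prec> x" for y
    proof (rule ccontr)
      assume "\<gamma> y \<noteq> \<gamma>' y"
      moreover have "y \<preceq> t"
        using le_trans[OF less_imp_le[OF that] xD(2)] .
      ultimately have "y \<in> D"
        by (simp add: D_def)
      then show False
        using x(2) that not_less by blast
    qed
    have "x \<preceq> s" "x \<preceq> s'"
      using le_trans[OF xD(2) t(1)] le_trans[OF xD(2) t(2)] .
    then have "conv \<alpha> \<gamma> (a \<otimes> x) - conv \<alpha> \<gamma>' (a \<otimes> x) = 0"
      using PD(2)[OF P(1) s(1) xG] PD(2)[OF P(2) s(2) xG] by simp
    then have "\<alpha> a * \<Phi> a (\<gamma> x - \<gamma>' x) = 0"
      using conv_diff[OF \<alpha>(1) a PD(1)[OF P(1)] PD(1)[OF P(2)] xG below] by simp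
    then show False
      using aG a0 xD(1) by simp
  qed
  \<comment> \<open>The union of all partial inverses: at each \<open>t\<close>, the value of any one that is nonzero there.\<close>
  define pick where "pick t = (SOME \<gamma>. \<gamma> \<in> P \<and> \<gamma> t \<noteq> 0)" for t
  define \<Gamma> where "\<Gamma> = (\<lambda>t. if \<exists>\<gamma>\<in>P. \<gamma> t \<noteq> 0 then pick t t else 0)"
  have \<Gamma>_eq: "\<Gamma> t = \<gamma> t" if \<gamma>: "\<gamma> \<in> P" "\<gamma> s \<noteq> 0" "t \<preceq> s" for \<gamma> s t
  proof (cases "\<exists>\<gamma>\<in>P. \<gamma> t \<noteq> 0")
    case True
    then have "\<exists>\<gamma>. \<gamma> \<in> P \<and> \<gamma> t \<noteq> 0"
      by blast
    from someI_ex[OF this] have "pick t \<in> P \<and> pick t t \<noteq> 0"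
      unfolding pick_def .
    then have "pick t t = \<gamma> t"
      using agree[OF _ \<gamma>(1) _ \<gamma>(2) le_refl \<gamma>(3)] by blast
    then show ?thesis
      using True by (simp add: \<Gamma>_def)
  qed (use \<gamma> in \<open>auto simp: \<Gamma>_def\<close>)
  have \<Gamma>_nz: "\<exists>\<gamma>\<in>P. \<gamma> s \<noteq> 0" if "\<Gamma> s \<noteq> 0" for s
    using that by (auto simp: \<Gamma>_def split: if_splits)
  have \<Gamma>G: "spt \<Gamma> \<subseteq> carrier G"
    using \<Gamma>_nz PD(1) spt_carrier by blast
  have "well_ordered (spt \<Gamma>)"
    unfolding well_ordered_def
  proof (intro allI impI, elim conjE)
    fix S assume S: "S \<subseteq> spt \<Gamma>" "S \<noteq> {}"
    then obtain s where s: "s \<in> S"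
      by blast
    then obtain \<gamma> where \<gamma>: "\<gamma> \<in> P" "\<gamma> s \<noteq> 0"
      using S \<Gamma>_nz by blast
    define T where "T = {t \<in> S. t \<preceq> s}"
    have "T \<subseteq> spt \<gamma>"
      using S \<Gamma>_eq[OF \<gamma>] by (auto simp: T_def)
    moreover have "T \<noteq> {}"
      using s by (auto simp: T_def)
    ultimately obtain x where x: "x \<in> T" "\<forall>t\<in>T. x \<preceq> t"
      by (rule obtain_least[OF series_wo[OF PD(1)[OF \<gamma>(1)]]])
    then have xS: "x \<in> S" "x \<preceq> s"
      by (simp_all add: T_def)
    have "x \<preceq> t" if t: "t \<in> S" for t
    proof (cases "t \<preceq> s")
      case True
      then show ?thesis
        using x(2) t by (simp add: T_def)
    next
      case False
      then have "s \<prec> t"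
        using linear[of t s] S s t \<Gamma>G by blast
      then show ?thesis
        using le_trans[OF xS(2) less_imp_le] by blast
    qed
    then show "\<exists>s\<in>S. \<forall>t\<in>S. s \<preceq> t"
      using xS(1) by blast
  qed
  then have \<Gamma>S: "\<Gamma> \<in> series"
    using \<Gamma>G by (simp add: series_def)
  have \<Gamma>P: "conv \<alpha> \<Gamma> (a \<otimes> t) = unit_series (a \<otimes> t)"
    if s: "\<Gamma> s \<noteq> 0" and t: "t \<in> carrier G" "t \<preceq> s" for s t
  proof -
    obtain \<gamma> where \<gamma>: "\<gamma> \<in> P" "\<gamma> s \<noteq> 0"
      using s \<Gamma>_nz by blast
    have "conv \<alpha> \<Gamma> (a \<otimes> t) = conv \<alpha> \<gamma> (a \<otimes> t)"
      by (rule conv_cong[OF \<alpha>(1) a \<Gamma>S PD(1)[OF \<gamma>(1)] t(1)])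
        (blast intro: \<Gamma>_eq[OF \<gamma>] le_trans[OF _ t(2)])
    then show ?thesis
      using PD(2)[OF \<gamma> t] by simp
  qed
  have "conv \<alpha> \<Gamma> = unit_series"
  proof (rule ccontr)
    assume neq: "conv \<alpha> \<Gamma> \<noteq> unit_series"
    define D where "D = {u. conv \<alpha> \<Gamma> u \<noteq> unit_series u}"
    have cS: "conv \<alpha> \<Gamma> \<in> series"
      using conv_closed \<alpha> \<Gamma>S by blast
    have sub: "D \<subseteq> spt (conv \<alpha> \<Gamma>) \<union> spt unit_series"
      by (auto simp: D_def)
    have "well_ordered (spt (conv \<alpha> \<Gamma>) \<union> spt unit_series)"
      using cS unit_series_closed by (intro well_ordered_Un) (simp_all add: series_wo series_carrier)
    moreover note sub
    moreover have "D \<noteq> {}"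
      using neq by (auto simp: D_def)
    ultimately obtain u where u: "u \<in> D" "\<forall>y\<in>D. u \<preceq> y"
      by (rule obtain_least)
    have uD: "conv \<alpha> \<Gamma> u \<noteq> unit_series u"
      using u(1) by (simp add: D_def)
    then have uG: "u \<in> carrier G"
      using spt_carrier[OF cS] spt_carrier[OF unit_series_closed] by metis
    \<comment> \<open>\<open>u\<close> is the first wrong coefficient of the product, and \<open>t\<close> the place that controls it.\<close>
    define t where "t = inv a \<otimes> u"
    have tG: "t \<in> carrier G" and ut: "u = a \<otimes> t"
      using aG uG by (simp_all add: t_def m_assoc[symmetric])
    have spt_below: "s \<prec> t" if "\<Gamma> s \<noteq> 0" for s
      using \<Gamma>P[OF that tG] linear[of t s] uD tG that \<Gamma>G by (auto simp: ut)
    then have \<Gamma>t: "\<Gamma> t = 0"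
      using irrefl by blast
    define e where "e = unit_series u - conv \<alpha> \<Gamma> u"
    \<comment> \<open>The coefficient at \<open>t\<close> whose product with the leading term of \<open>\<alpha>\<close> supplies the defect \<open>e\<close>.\<close>
    define c where "c = \<Phi> (inv a) (inverse (\<alpha> a) * e)"
    have c: "\<alpha> a * \<Phi> a c = e"
      using a0 aG by (simp add: c_def act_inv mult.assoc[symmetric])
    have "e \<noteq> 0"
      using uD by (simp add: e_def)
    then have c0: "c \<noteq> 0"
      using c aG by auto
    let ?\<gamma> = "\<Gamma>(t := c)"
    have spt\<gamma>: "spt ?\<gamma> = spt \<Gamma> \<union> {t}"
      using c0 by auto
    have "well_ordered {t}"
      by (auto simp: well_ordered_def subset_singleton_iff)
    then have "well_ordered (spt ?\<gamma>)"
      unfolding spt\<gamma> using series_wo[OF \<Gamma>S] \<Gamma>G tG by (intro well_ordered_Un) auto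
    moreover have "spt ?\<gamma> \<subseteq> carrier G"
      unfolding spt\<gamma> using \<Gamma>G tG by auto
    ultimately have \<gamma>S: "?\<gamma> \<in> series"
      unfolding series_def by blast
    have "conv \<alpha> ?\<gamma> (a \<otimes> x) = unit_series (a \<otimes> x)"
      if s: "?\<gamma> s \<noteq> 0" and x: "x \<in> carrier G" "x \<preceq> s" for s x
    proof -
      have "s \<preceq> t"
        using s spt_below less_imp_le by (cases "s = t") auto
      then have xt: "x \<preceq> t"
        using le_trans[OF x(2)] by blast
      show ?thesis
      proof (cases "x = t")
        case True
        have "conv \<alpha> ?\<gamma> (a \<otimes> t) - conv \<alpha> \<Gamma> (a \<otimes> t) = \<alpha> a * \<Phi> a (?\<gamma> t - \<Gamma> t)"
          using irrefl by (intro conv_diff[OF \<alpha>(1) a \<gamma>S \<Gamma>S tG]) auto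
        then show ?thesis
          using True by (simp add: \<Gamma>t c e_def ut)
      next
        case False
        then have xlt: "x \<prec> t"
          using xt by (simp add: le_def)
        then have "conv \<alpha> ?\<gamma> (a \<otimes> x) = conv \<alpha> \<Gamma> (a \<otimes> x)"
          using not_less by (intro conv_cong[OF \<alpha>(1) a \<gamma>S \<Gamma>S x(1)]) auto
        moreover have "a \<otimes> x \<prec> u"
          using mult_strict_left_mono[OF x(1) tG aG xlt] by (simp add: ut)
        then have "a \<otimes> x \<notin> D"
          using u(2) not_less by blast
        ultimately show ?thesis
          by (simp add: D_def)
      qed
    qed
    then have "?\<gamma> \<in> P"
      using \<gamma>S by (auto simp: P_def)
    then have "\<Gamma> t = ?\<gamma> t"
      using c0 by (intro \<Gamma>_eq[of ?\<gamma> t t]) auto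
    then show False
      using \<Gamma>t c0 by simp
  qed
  then show ?thesis
    using \<Gamma>S by blast
qed

end

section \<open>Groups with infinitely many dihedral coordinates\<close>

lemma finite_image_factor:
  assumes "finite (r ` C)" and "\<And>a b. a \<in> C \<Longrightarrow> b \<in> C \<Longrightarrow> r a = r b \<Longrightarrow> g a = g b"
  shows "finite (g ` C)"
proof -
  have "g ` C \<subseteq> (\<lambda>v. g (inv_into C r v)) ` (r ` C)"
  proof
    fix y assume "y \<in> g ` C"
    then obtain a where a: "a \<in> C" "y = g a"
      by blast
    then have "g a = g (inv_into C r (r a))"
      by (intro assms(2)) (simp_all add: inv_into_into f_inv_into_f)
    then show "y \<in> (\<lambda>v. g (inv_into C r v)) ` (r ` C)"
      using a by blast
  qed
  then show ?thesis
    using assms(1) by (meson finite_imageI finite_subset)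
qed

text \<open>The isometries of the integers, an infinite dihedral group.\<close>

definition dihedral_maps :: "(int \<Rightarrow> int) set" where
  "dihedral_maps = {\<lambda>z. b + s * z |b s. s = 1 \<or> s = -1}"

text \<open>A group with homomorphisms \<open>f n\<close> to the isometries of the integers such that every element is
  trivial in almost all coordinates. In coordinate \<open>n\<close> the element \<open>reflection n\<close> is the reflection at
  \<open>0\<close> and \<open>shift n\<close> the translation by \<open>1\<close>; \<open>reflection n\<close> fixes \<open>0\<close> in all coordinates.\<close>

locale dihedral_coordinates = group A for A :: "('a, 'b) monoid_scheme" (structure) +
  fixes f :: "nat \<Rightarrow> 'a \<Rightarrow> int \<Rightarrow> int"
    and reflection shift :: "nat \<Rightarrow> 'a"
  assumes f_dihedral: "x \<in> carrier A \<Longrightarrow> f n x \<in> dihedral_maps"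
    and f_mult: "x \<in> carrier A \<Longrightarrow> y \<in> carrier A \<Longrightarrow> f n (x \<otimes> y) = f n x \<circ> f n y"
    and f_finite: "x \<in> carrier A \<Longrightarrow> finite {n. f n x \<noteq> id}"
    and reflection_closed: "reflection n \<in> carrier A"
    and f_reflection: "f n (reflection n) z = - z"
    and f_reflection_zero: "f m (reflection n) 0 = 0"
    and shift_closed: "shift n \<in> carrier A"
    and f_shift: "f n (shift n) z = 1 + z"
begin

lemma f_form:
  assumes "x \<in> carrier A"
  obtains s where "s = 1 \<or> s = -1" "\<forall>z. f n x z = f n x 0 + s * z"
proof -
  obtain b s where "s = 1 \<or> s = -1" "f n x = (\<lambda>z. b + s * z)"
    using f_dihedral[OF assms, of n] unfolding dihedral_maps_def by blast
  then show thesis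
    by (intro that[of s]) simp_all
qed

lemma f_one: "f n \<one> = id"
proof -
  obtain s where s: "s = 1 \<or> s = -1" "\<forall>z. f n \<one> z = f n \<one> 0 + s * z"
    using one_closed by (rule f_form)
  define b where "b = f n \<one> 0"
  have f: "f n \<one> z = b + s * z" for z
    unfolding b_def by (rule s(2)[rule_format])
  have idem: "f n \<one> (f n \<one> z) = f n \<one> z" for z
    using fun_cong[OF f_mult[OF one_closed one_closed, of n], of z] by simp
  have "b = 0"
    using idem[of 0] s(1) by (auto simp: f)
  moreover have "s = 1"
    using idem[of 1] s(1) \<open>b = 0\<close> by (auto simp: f)
  ultimately show ?thesis
    by (auto simp: fun_eq_iff f)
qed

lemma f_inv:
  assumes "x \<in> carrier A"
  shows "f n x (f n (inv x) z) = z"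
  using f_mult[OF assms inv_closed[OF assms], of n] assms by (metis comp_apply f_one id_apply r_inv)

text \<open>The elements that, in every coordinate \<open>n\<close>, move \<open>0\<close> by a multiple of \<open>m n\<close>.\<close>

definition zero_mod :: "(nat \<Rightarrow> int) \<Rightarrow> 'a set" where
  "zero_mod m = {x \<in> carrier A. \<forall>n. m n dvd f n x 0}"

lemma zero_mod_subgroup: "subgroup (zero_mod m) A"
proof
  show "zero_mod m \<subseteq> carrier A"
    by (auto simp: zero_mod_def)
  show "\<one> \<in> zero_mod m"
    by (simp add: zero_mod_def f_one)
next
  fix x y assume xy: "x \<in> zero_mod m" "y \<in> zero_mod m"
  have "m n dvd f n (x \<otimes> y) 0" for n
  proof -
    have "x \<in> carrier A"
      using xy(1) by (simp add: zero_mod_def)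
    then obtain s where "s = 1 \<or> s = -1" and s: "\<forall>z. f n x z = f n x 0 + s * z"
      by (rule f_form)
    have "f n (x \<otimes> y) 0 = f n x 0 + s * f n y 0"
      using xy s[rule_format, of "f n y 0"] by (simp add: zero_mod_def f_mult)
    then show ?thesis
      using xy by (simp add: zero_mod_def)
  qed
  then show "x \<otimes> y \<in> zero_mod m"
    using xy by (simp add: zero_mod_def)
next
  fix x assume x: "x \<in> zero_mod m"
  then have xA: "x \<in> carrier A"
    by (simp add: zero_mod_def)
  have "m n dvd f n (inv x) 0" for n
  proof -
    obtain s where s: "s = 1 \<or> s = -1" "\<forall>z. f n x z = f n x 0 + s * z"
      using xA by (rule f_form)
    have "f n x 0 + s * f n (inv x) 0 = 0"
      using f_inv[OF xA, of n 0] s(2)[rule_format, of "f n (inv x) 0"] by simp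
    then have "f n (inv x) 0 = - s * f n x 0"
      using s(1) by auto
    then show ?thesis
      using x by (simp add: zero_mod_def)
  qed
  then show "inv x \<in> zero_mod m"
    using xA by (simp add: zero_mod_def)
qed

lemma zero_mod_mono: "(\<And>n. m n dvd m' n) \<Longrightarrow> zero_mod m' \<subseteq> zero_mod m"
  unfolding zero_mod_def using dvd_trans by blast

lemma zero_mod_one: "zero_mod (\<lambda>n. 1) = carrier A"
  by (simp add: zero_mod_def)

text \<open>Conjugating \<open>h\<close>, with \<open>z \<mapsto> d + e z\<close>, by \<open>z \<mapsto> b + s z\<close> changes the value \<open>d\<close> at \<open>0\<close> to
  \<open>s d + (1 - e) b\<close>, where \<open>1 - e\<close> is \<open>0\<close> or \<open>2\<close>.\<close>

lemma zero_mod_normal: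
  assumes m: "\<And>n. m n dvd m' n" "\<And>n. m' n dvd 2 * m n"
  shows "zero_mod m' \<lhd> A\<lparr>carrier := zero_mod m\<rparr>"
proof -
  interpret M: group "A\<lparr>carrier := zero_mod m\<rparr>"
    by (rule subgroup.subgroup_is_group[OF zero_mod_subgroup group_axioms])
  have sub: "zero_mod m' \<subseteq> zero_mod m"
    using m(1) by (rule zero_mod_mono)
  have "x \<otimes> h \<otimes> inv x \<in> zero_mod m'" if x: "x \<in> zero_mod m" and h: "h \<in> zero_mod m'" for x h
  proof -
    have xA: "x \<in> carrier A" and hA: "h \<in> carrier A"
      using x h by (simp_all add: zero_mod_def)
    have "m' n dvd f n (x \<otimes> h \<otimes> inv x) 0" for n
    proof -
      let ?c = "f n (inv x) 0"
      obtain s where s: "s = 1 \<or> s = -1" "\<forall>z. f n x z = f n x 0 + s * z"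
        using xA by (rule f_form)
      obtain e where e: "e = 1 \<or> e = -1" "\<forall>z. f n h z = f n h 0 + e * z"
        using hA by (rule f_form)
      have "s * ?c = - f n x 0"
        using f_inv[OF xA, of n 0] s(2)[rule_format, of ?c] by simp
      moreover have "f n (x \<otimes> h \<otimes> inv x) 0 = f n x 0 + s * (f n h 0 + e * ?c)"
        using xA hA by (simp add: f_mult e(2)[rule_format, of ?c] s(2)[rule_format, of "f n h 0 + e * ?c"])
      ultimately have "f n (x \<otimes> h \<otimes> inv x) 0 = s * f n h 0 + (1 - e) * f n x 0"
        by (simp add: algebra_simps)
      moreover have "m' n dvd (1 - e) * f n x 0"
      proof -
        have "m n dvd f n x 0"
          using x by (simp add: zero_mod_def)
        then have "2 * m n dvd 2 * f n x 0"
          by simp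
        then have "m' n dvd 2 * f n x 0"
          using m(2) dvd_trans by blast
        then show ?thesis
          using e(1) by auto
      qed
      ultimately show ?thesis
        using h by (simp add: zero_mod_def)
    qed
    then show ?thesis
      using xA hA by (simp add: zero_mod_def)
  qed
  then show ?thesis
    using sub by (simp add: M.normal_inv_iff subgroup_incl zero_mod_subgroup m_inv_consistent)
qed

text \<open>The coset of \<open>a\<close> is determined by the value of \<open>f 0 (inv a)\<close> at \<open>0\<close> modulo \<open>k\<close>.\<close>

lemma zero_mod_finite_index:
  assumes "k > 0"
  shows "finite (rcosets (zero_mod (\<lambda>n. if n = 0 then k else 1)))" (is "finite (rcosets ?H)")
proof -
  have H: "subgroup ?H A"
    by (rule zero_mod_subgroup)
  have "finite ((\<lambda>a. ?H #> a) ` carrier A)"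
  proof (rule finite_image_factor)
    show "finite ((\<lambda>a. f 0 (inv a) 0 mod k) ` carrier A)"
      by (rule finite_subset[of _ "{0..<k}"]) (use assms in auto)
    fix a b assume a: "a \<in> carrier A" and b: "b \<in> carrier A"
      and eq: "f 0 (inv a) 0 mod k = f 0 (inv b) 0 mod k"
    obtain s where "s = 1 \<or> s = -1" and s: "\<forall>z. f 0 a z = f 0 a 0 + s * z"
      using a by (rule f_form)
    have "f 0 a 0 + s * f 0 (inv a) 0 = 0"
      using f_inv[OF a, of 0 0] s[rule_format, of "f 0 (inv a) 0"] by simp
    then have "f 0 (a \<otimes> inv b) 0 = s * (f 0 (inv b) 0 - f 0 (inv a) 0)"
      using a b s[rule_format, of "f 0 (inv b) 0"] by (simp add: f_mult algebra_simps)
    moreover have "k dvd f 0 (inv b) 0 - f 0 (inv a) 0"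
      using eq by (simp add: mod_eq_dvd_iff dvd_diff_commute)
    ultimately have "a \<otimes> inv b \<in> ?H"
      using a b by (simp add: zero_mod_def)
    moreover have "a = (a \<otimes> inv b) \<otimes> b"
      using a b by (simp add: m_assoc)
    ultimately have "a \<in> ?H #> b"
      using rcosI[of "a \<otimes> inv b" ?H b] b subgroup.subset[OF H] by simp
    then show "?H #> a = ?H #> b"
      using repr_independence[OF _ b H] by simp
  qed
  moreover have "rcosets ?H = (\<lambda>a. ?H #> a) ` carrier A"
    by (auto simp: RCOSETS_def)
  ultimately show ?thesis
    by simp
qed

text \<open>A step of finite index is invisible in almost every coordinate, because the finitely many coset
  representatives are trivial there.\<close>

lemma finite_index_coordinates:
  assumes S: "subgroup S A" and H: "H \<subseteq> S"
    and fin: "finite (rcosets\<^bsub>A\<lparr>carrier := S\<rparr>\<^esub> H)" and one: "\<one> \<in> H"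
  shows "finite {n. \<not> f n ` S \<subseteq> f n ` H}"
proof -
  have SA: "S \<subseteq> carrier A"
    using S by (rule subgroup.subset)
  have "rcosets\<^bsub>A\<lparr>carrier := S\<rparr>\<^esub> H = (\<lambda>a. H #> a) ` S"
    by (auto simp: RCOSETS_def r_coset_def)
  then obtain R where R: "R \<subseteq> S" "finite R" "(\<lambda>a. H #> a) ` S = (\<lambda>a. H #> a) ` R"
    using fin finite_subset_image[of "(\<lambda>a. H #> a) ` S" "\<lambda>a. H #> a" S] by auto
  have "{n. \<not> f n ` S \<subseteq> f n ` H} \<subseteq> (\<Union>r\<in>R. {n. f n r \<noteq> id})"
  proof (rule ccontr)
    assume "\<not> {n. \<not> f n ` S \<subseteq> f n ` H} \<subseteq> (\<Union>r\<in>R. {n. f n r \<noteq> id})"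
    then obtain n x where n: "\<And>r. r \<in> R \<Longrightarrow> f n r = id" and x: "x \<in> S" "f n x \<notin> f n ` H"
      by blast
    obtain r where r: "r \<in> R" "H #> x = H #> r"
      using R(3) x(1) by blast
    have "x \<in> H #> x"
      using one x(1) SA unfolding r_coset_def by force
    then obtain h where h: "h \<in> H" "x = h \<otimes> r"
      using r(2) unfolding r_coset_def by blast
    then have "f n x = f n h"
      using f_mult[of h r n] n[OF r(1)] H SA R(1) r(1) by auto
    then show False
      using h(1) x(2) by blast
  qed
  moreover have "finite (\<Union>r\<in>R. {n. f n r \<noteq> id})"
    using R(1,2) SA f_finite by blast
  ultimately show ?thesis
    by (rule finite_subset)
qed

text \<open>The product of \<open>x r x\<inverse>\<close> and \<open>r\<close>, for a translation \<open>x\<close> by \<open>a\<close> and the reflection \<open>r\<close> at \<open>0\<close>,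
  is the translation by \<open>2 a\<close>.\<close>

lemma normal_step_doubles:
  assumes S: "subgroup S A" and H: "H \<lhd> A\<lparr>carrier := S\<rparr>" and r: "reflection n \<in> H"
    and x: "x \<in> S" "\<And>z. f n x z = a + z"
  shows "\<exists>y\<in>H. \<forall>z. f n y z = 2 * a + z"
proof -
  let ?r = "reflection n"
  have xA: "x \<in> carrier A"
    using subgroup.mem_carrier[OF S x(1)] .
  note rA = reflection_closed[of n]
  have "x \<otimes> ?r \<otimes> inv x \<in> H"
    using normal.inv_op_closed2[OF H, of x ?r] x(1) r S by (simp add: m_inv_consistent)
  then have "x \<otimes> ?r \<otimes> inv x \<otimes> ?r \<in> H"
    using subgroup.m_closed[OF normal_imp_subgroup[OF H] _ r] by simp
  moreover have inv: "f n (inv x) z = z - a" for z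
    using f_inv[OF xA, of n z] x(2)[of "f n (inv x) z"] by linarith
  have "f n (x \<otimes> ?r \<otimes> inv x \<otimes> ?r) z = 2 * a + z" for z
    using xA rA by (simp add: f_mult f_reflection inv x(2))
  ultimately show ?thesis
    by blast
qed

abbreviation normal_step :: "(nat \<Rightarrow> 'a set) \<Rightarrow> nat \<Rightarrow> bool" where
  "normal_step S i \<equiv> S (Suc i) \<lhd> A\<lparr>carrier := S i\<rparr>"

lemma almost_normal_seriesD:
  assumes "almost_normal_series A l S N"
  shows "S 0 = carrier A" "S l = N" "\<And>i. i \<le> l \<Longrightarrow> subgroup (S i) A"
    "\<And>i. i < l \<Longrightarrow> S (Suc i) \<subseteq> S i"
    "\<And>i. i < l \<Longrightarrow> \<not> normal_step S i \<Longrightarrow> finite (rcosets\<^bsub>A\<lparr>carrier := S i\<rparr>\<^esub> S (Suc i))"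
  using assms by (auto simp: almost_normal_series_def)

text \<open>In a coordinate in which the other steps are invisible, the \<open>i\<close>-th group still contains an
  element that acts as the translation by \<open>2 ^ k\<close>, where \<open>k\<close> is the number of normal steps before it.\<close>

lemma almost_normal_series_translations:
  assumes S: "almost_normal_series A l S N" and refl: "reflection n \<in> N"
    and n: "\<And>i. i < l \<Longrightarrow> \<not> normal_step S i \<Longrightarrow> f n ` S i \<subseteq> f n ` S (Suc i)"
    and i: "i \<le> l"
  shows "\<exists>x\<in>S i. \<forall>z. f n x z = 2 ^ card {j. j < i \<and> normal_step S j} + z"
  using i
proof (induction i)
  case 0
  then show ?case
    using almost_normal_seriesD(1)[OF S] shift_closed f_shift
    by (intro bexI[of _ "shift n"]) auto
next
  case (Suc i)
  then obtain x where x: "x \<in> S i" "\<And>z. f n x z = 2 ^ card {j. j < i \<and> normal_step S j} + z"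
    by auto
  show ?case
  proof (cases "normal_step S i")
    case True
    have "N \<subseteq> S (Suc i)"
      using Suc.prems
    proof (induction rule: inc_induct)
      case base
      then show ?case
        using almost_normal_seriesD(2)[OF S] by simp
    next
      case (step k)
      then show ?case
        using almost_normal_seriesD(4)[OF S, of k] by auto
    qed
    then have "\<exists>y\<in>S (Suc i). \<forall>z. f n y z = 2 * 2 ^ card {j. j < i \<and> normal_step S j} + z"
      using normal_step_doubles[OF almost_normal_seriesD(3)[OF S] True _ x] refl Suc.prems by auto
    moreover have "{j. j < Suc i \<and> normal_step S j} = insert i {j. j < i \<and> normal_step S j}"
      using True by (auto simp: less_Suc_eq)
    ultimately show ?thesis
      by simp
  next
    case False
    then have "{j. j < Suc i \<and> normal_step S j} = {j. j < i \<and> normal_step S j}"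
      by (auto simp: less_Suc_eq)
    moreover have "f n x \<in> f n ` S (Suc i)"
      using n[of i] False Suc.prems x(1) by auto
    then obtain y where "y \<in> S (Suc i)" "f n y = f n x"
      by auto
    ultimately show ?thesis
      using x(2) by (intro bexI[of _ y]) simp_all
  qed
qed

text \<open>The moduli of the \<open>i\<close>-th group of the series. The first step, from the whole group, imposes
  the modulus \<open>3\<close> in coordinate \<open>0\<close>, which prevents subnormality; each later step doubles the modulus
  in all other coordinates, which forces as many normal steps.\<close>

definition modulus :: "nat \<Rightarrow> nat \<Rightarrow> int" where
  "modulus i n = (if i = 0 then 1 else if n = 0 then 3 else 2 ^ (i - 1))"

lemma reflection_zero_mod: "reflection n \<in> zero_mod m"
  by (simp add: zero_mod_def reflection_closed f_reflection_zero)

lemma modulus_series: "almost_normal_series A r (\<lambda>i. zero_mod (modulus i)) (zero_mod (modulus r))"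
proof -
  have m0: "modulus 0 = (\<lambda>n. 1)" and m1: "modulus (Suc 0) = (\<lambda>n. if n = 0 then 3 else 1)"
    by (auto simp: modulus_def)
  have dvd: "modulus i n dvd modulus (Suc i) n" for i n
    by (auto simp: modulus_def intro: le_imp_power_dvd)
  have step: "zero_mod (modulus (Suc i)) \<lhd> A\<lparr>carrier := zero_mod (modulus i)\<rparr> \<or>
    finite (rcosets\<^bsub>A\<lparr>carrier := zero_mod (modulus i)\<rparr>\<^esub> zero_mod (modulus (Suc i)))" for i
  proof (cases i)
    case 0
    then show ?thesis
      using zero_mod_finite_index[of 3] by (simp add: m0 m1 zero_mod_one)
  next
    case (Suc j)
    have "modulus (Suc i) n dvd 2 * modulus i n" for n
      by (simp add: Suc modulus_def)
    then show ?thesis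
      using zero_mod_normal dvd by blast
  qed
  show ?thesis
    unfolding almost_normal_series_def
    using step zero_mod_subgroup zero_mod_mono[OF dvd] by (simp add: m0 zero_mod_one)
qed

text \<open>If all steps were normal, the last group would act in coordinate \<open>0\<close> by a translation by a
  power of \<open>2\<close>, which is not divisible by \<open>3\<close>.\<close>

lemma some_step_not_normal:
  assumes r: "r > 0" and S: "almost_normal_series A l S (zero_mod (modulus r))"
  shows "\<exists>i<l. \<not> normal_step S i"
proof (rule ccontr)
  assume "\<not> (\<exists>i<l. \<not> normal_step S i)"
  then obtain x where x: "x \<in> S l" "f 0 x 0 = 2 ^ card {j. j < l \<and> normal_step S j}"
    using almost_normal_series_translations[OF S reflection_zero_mod, of 0 l] by auto
  then have "3 dvd (2 :: int) ^ card {j. j < l \<and> normal_step S j}"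
    using almost_normal_seriesD(2)[OF S] r by (auto simp: zero_mod_def modulus_def split: if_splits)
  moreover have "coprime (3 :: int) (2 ^ k)" for k
    by simp
  ultimately show False
    using coprime_common_divisor_int[of 3 _ 3] by fastforce
qed

text \<open>Choose \<open>n > 0\<close> outside the finitely many coordinates in which a step of finite index is visible.
  The translation by \<open>2 ^ k\<close> in the last group, for \<open>k\<close> the number of normal steps, gives
  \<open>r - 1 \<le> k\<close>; as some step is not normal, the length exceeds \<open>k\<close>.\<close>

theorem almost_subnormal_not_subnormal:
  assumes r: "r > 0"
  shows "almost_subnormal A r (zero_mod (modulus r)) \<and> \<not> subnormal A (zero_mod (modulus r))"
proof
  show "\<not> subnormal A (zero_mod (modulus r))"
  proof
    assume "subnormal A (zero_mod (modulus r))"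
    then obtain l S where S: "S 0 = carrier A" "S l = zero_mod (modulus r)"
      "\<forall>i\<le>l. subgroup (S i) A" "\<forall>i<l. normal_step S i"
      unfolding subnormal_def by blast
    have "S (Suc i) \<subseteq> S i" if "i < l" for i
      using subgroup.subset[OF normal_imp_subgroup, of "S (Suc i)" "A\<lparr>carrier := S i\<rparr>"] S(4) that
      by simp
    then have "almost_normal_series A l S (zero_mod (modulus r))"
      using S by (simp add: almost_normal_series_def)
    then show False
      using some_step_not_normal[OF r] S(4) by blast
  qed
  have "r \<le> l" if S: "almost_normal_series A l S (zero_mod (modulus r))" for l S
  proof -
    let ?bad = "\<lambda>i. {n. \<not> f n ` S i \<subseteq> f n ` S (Suc i)}"
    have "finite (?bad i)" if "i < l" "\<not> normal_step S i" for i
    proof (rule finite_index_coordinates)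
      show "\<one> \<in> S (Suc i)"
        using almost_normal_seriesD(3)[OF S, of "Suc i"] that(1) by (simp add: subgroup.one_closed)
    qed (use that almost_normal_seriesD(3,4,5)[OF S] in auto)
    then have "finite (insert 0 (\<Union>i\<in>{i. i < l \<and> \<not> normal_step S i}. ?bad i))"
      by simp
    then obtain n where n: "n \<notin> insert 0 (\<Union>i\<in>{i. i < l \<and> \<not> normal_step S i}. ?bad i)"
      using ex_new_if_finite[OF infinite_UNIV_nat] by blast
    let ?k = "card {j. j < l \<and> normal_step S j}"
    obtain x where x: "x \<in> S l" "\<forall>z. f n x z = 2 ^ ?k + z"
      using almost_normal_series_translations[OF S reflection_zero_mod, of n l] n by blast
    have "modulus r n dvd f n x 0"
      using almost_normal_seriesD(2)[OF S] x(1) by (simp add: zero_mod_def)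
    then have "modulus r n dvd 2 ^ ?k"
      using x(2)[rule_format, of 0] by simp
    then have "r - 1 \<le> ?k"
      using n r by (simp add: modulus_def dvd_power_iff)
    moreover obtain i where "i < l" "\<not> normal_step S i"
      using some_step_not_normal[OF r S] by blast
    then have "{j. j < l \<and> normal_step S j} \<subset> {..<l}"
      by auto
    then have "?k < card {..<l}"
      by (intro psubset_card_mono) simp_all
    ultimately show ?thesis
      by simp
  qed
  then show "almost_subnormal A r (zero_mod (modulus r))"
    using modulus_series unfolding almost_subnormal_def by blast
qed

end

section \<open>The group of nonzero series\<close>

context twisted_series
begin

text \<open>The multiplicative group of nonzero series.\<close>

definition nonzero_group :: "('g \<Rightarrow> 'k) monoid" where
  "nonzero_group = \<lparr>carrier = series - {\<lambda>g. 0}, mult = conv, one = unit_series\<rparr>"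

lemma conv_nonzero:
  assumes "\<alpha> \<in> series - {\<lambda>g. 0}" "\<beta> \<in> series - {\<lambda>g. 0}"
  shows "conv \<alpha> \<beta> \<in> series - {\<lambda>g. 0}"
proof -
  obtain a b where "leads \<alpha> a" "leads \<beta> b"
    using leads_exists[of \<alpha>] leads_exists[of \<beta>] assms by auto
  then have "leads (conv \<alpha> \<beta>) (a \<otimes> b)"
    using leads_conv assms by blast
  then show ?thesis
    using conv_closed assms by (auto simp: leads_def)
qed

text \<open>A right inverse of each element suffices: a right inverse of the right inverse of \<open>\<alpha>\<close> is
  \<open>\<alpha>\<close> itself.\<close>

lemma group_nonzero_group: "group nonzero_group"
proof (rule groupI)
  have right: "\<exists>\<beta>\<in>series - {\<lambda>g. 0}. conv \<alpha> \<beta> = unit_series"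
    if \<alpha>: "\<alpha> \<in> series - {\<lambda>g. 0}" for \<alpha>
  proof -
    obtain \<beta> where \<beta>: "\<beta> \<in> series" "conv \<alpha> \<beta> = unit_series"
      using right_inverse_exists[of \<alpha>] \<alpha> by auto
    have "conv \<alpha> (\<lambda>g. 0) = (\<lambda>g. 0)"
      by (simp add: conv_def fun_eq_iff)
    then have "\<beta> \<noteq> (\<lambda>g. 0)"
      using \<beta>(2) unit_series_nonzero by auto
    then show ?thesis
      using \<beta> by blast
  qed
  fix \<alpha> assume "\<alpha> \<in> carrier nonzero_group"
  then have \<alpha>: "\<alpha> \<in> series - {\<lambda>g. 0}"
    by (simp add: nonzero_group_def)
  then obtain \<beta> where \<beta>: "\<beta> \<in> series - {\<lambda>g. 0}" "conv \<alpha> \<beta> = unit_series"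
    using right by blast
  then obtain \<gamma> where \<gamma>: "\<gamma> \<in> series - {\<lambda>g. 0}" "conv \<beta> \<gamma> = unit_series"
    using right by blast
  have "\<alpha> = conv \<alpha> (conv \<beta> \<gamma>)"
    using \<alpha> \<gamma> by (simp add: conv_unit_right)
  also have "\<dots> = conv (conv \<alpha> \<beta>) \<gamma>"
    using \<alpha> \<beta>(1) \<gamma>(1) by (auto intro!: conv_assoc[symmetric])
  also have "\<dots> = \<gamma>"
    using \<beta> \<gamma> by (simp add: conv_unit_left)
  finally show "\<exists>\<beta>\<in>carrier nonzero_group. \<beta> \<otimes>\<^bsub>nonzero_group\<^esub> \<alpha> = \<one>\<^bsub>nonzero_group\<^esub>"
    using \<beta>(1) \<gamma>(2) by (auto simp: nonzero_group_def)
qed (use conv_nonzero conv_assoc conv_unit_left unit_series_closed unit_series_nonzero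
  in \<open>auto simp: nonzero_group_def\<close>)

text \<open>The least element of the support; meaningful for nonzero series. It is a homomorphism
  from the group of nonzero series onto the ordered group.\<close>

definition lead :: "('g \<Rightarrow> 'k) \<Rightarrow> 'g" where
  "lead \<alpha> = (THE g. leads \<alpha> g)"

lemma lead_eq: "leads \<alpha> g \<Longrightarrow> lead \<alpha> = g"
  unfolding lead_def using leads_unique by blast

lemma leads_lead: "\<alpha> \<in> carrier nonzero_group \<Longrightarrow> leads \<alpha> (lead \<alpha>)"
  using leads_exists[of \<alpha>] lead_eq by (auto simp: nonzero_group_def)

lemma lead_mult:
  assumes "\<alpha> \<in> carrier nonzero_group" "\<beta> \<in> carrier nonzero_group"
  shows "lead (\<alpha> \<otimes>\<^bsub>nonzero_group\<^esub> \<beta>) = lead \<alpha> \<otimes> lead \<beta>"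
  using assms leads_lead[OF assms(1)] leads_lead[OF assms(2)]
  by (auto simp: nonzero_group_def intro!: lead_eq leads_conv)

text \<open>The series of a single group element, with coefficient \<open>1\<close>.\<close>

definition monomial :: "'g \<Rightarrow> 'g \<Rightarrow> 'k" where
  "monomial g h = (if h = g then 1 else 0)"

lemma monomial_closed:
  assumes "g \<in> carrier G"
  shows "monomial g \<in> carrier nonzero_group"
proof -
  have "spt (monomial g) = {g}"
    by (auto simp: monomial_def)
  moreover have "monomial g \<noteq> (\<lambda>h. 0)"
    by (auto simp: monomial_def fun_eq_iff)
  ultimately show ?thesis
    using assms
    by (auto simp: nonzero_group_def series_def well_ordered_def subset_singleton_iff)
qed

lemma lead_monomial: "lead (monomial g) = g"
  by (rule lead_eq) (auto simp: leads_def monomial_def)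

end

lemma twisted_series_free_grp:
  assumes "\<Phi> \<in> hom free_grp ring_aut_grp"
  shows "twisted_series free_grp dict_less \<Phi>"
proof -
  interpret ordered_group free_grp dict_less
    by (rule ordered_group_free_grp)
  have aut: "bij (\<Phi> g)" "\<Phi> g 1 = 1" "\<Phi> g (a + b) = \<Phi> g a + \<Phi> g b" "\<Phi> g (a * b) = \<Phi> g a * \<Phi> g b"
    if "g \<in> carrier free_grp" for g a b
  proof -
    have "\<Phi> g \<in> carrier ring_aut_grp"
      using assms that by (rule hom_in_carrier)
    then show "bij (\<Phi> g)" "\<Phi> g 1 = 1" "\<Phi> g (a + b) = \<Phi> g a + \<Phi> g b"
      "\<Phi> g (a * b) = \<Phi> g a * \<Phi> g b"
      by (simp_all add: ring_aut_grp_def)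
  qed
  have comp: "\<Phi> (g \<otimes>\<^bsub>free_grp\<^esub> h) = \<Phi> g \<circ> \<Phi> h"
    if "g \<in> carrier free_grp" "h \<in> carrier free_grp" for g h
    using assms that by (auto simp: hom_def ring_aut_grp_def)
  have "\<Phi> \<one>\<^bsub>free_grp\<^esub> (\<Phi> \<one>\<^bsub>free_grp\<^esub> a) = \<Phi> \<one>\<^bsub>free_grp\<^esub> a" for a
    using comp[OF one_closed one_closed] by (simp add: fun_eq_iff)
  then have "\<Phi> \<one>\<^bsub>free_grp\<^esub> a = a" for a
    using aut(1)[OF one_closed] by (meson bij_is_inj injD)
  then show ?thesis
    by unfold_locales (simp_all add: aut comp)
qed

lemma mult_of_malcev_neumann:
  assumes "\<Phi> \<in> hom free_grp ring_aut_grp"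
  shows "mult_of (malcev_neumann \<Phi>) = twisted_series.nonzero_group free_grp dict_less \<Phi>"
proof -
  interpret twisted_series free_grp dict_less \<Phi>
    using assms by (rule twisted_series_free_grp)
  have "dict_well_ordered = well_ordered"
    by (simp add: dict_well_ordered_def well_ordered_def le_def fun_eq_iff)
  then show ?thesis
    by (simp add: mult_of_def malcev_neumann_def nonzero_group_def series_def supp_def
        conv_def unit_series_def fun_eq_iff)
qed

section \<open>Dihedral coordinates of the free group\<close>

text \<open>The generator \<open>2 n\<close> acts in coordinate \<open>n\<close> as the reflection at \<open>0\<close>, the generator
  \<open>2 n + 1\<close> as the translation by \<open>1\<close>; all other coordinates are trivial.\<close>

definition letter_map :: "nat \<Rightarrow> letter \<Rightarrow> int \<Rightarrow> int" where
  "letter_map n p z =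
     (if fst p = 2 * n then - z
      else if fst p = 2 * n + 1 then (if snd p then 1 else -1) + z
      else z)"

text \<open>The homomorphism from the free group to the isometries of the integers in coordinate \<open>n\<close>.\<close>

definition word_map :: "nat \<Rightarrow> fword \<Rightarrow> int \<Rightarrow> int" where
  "word_map n w = foldr (\<lambda>p g. letter_map n p \<circ> g) w id"

lemma word_map_Nil [simp]: "word_map n [] = id"
  and word_map_Cons [simp]: "word_map n (p # w) = letter_map n p \<circ> word_map n w"
  by (simp_all add: word_map_def)

lemma letter_map_inverse: "letter_map n p (letter_map n (inv_letter p) z) = z"
  by (simp add: letter_map_def inv_letter_def)

lemma word_map_push_letter: "word_map n (push_letter p w) = letter_map n p \<circ> word_map n w"
  by (cases w) (auto simp: fun_eq_iff letter_map_inverse)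

lemma word_map_mult: "word_map n (u \<otimes>\<^bsub>free_grp\<^esub> v) = word_map n u \<circ> word_map n v"
  unfolding mult_free_grp by (induction u) (simp_all add: word_map_push_letter comp_assoc)

lemma dihedral_mapsI: "s = 1 \<or> s = -1 \<Longrightarrow> (\<And>z. g z = b + s * z) \<Longrightarrow> g \<in> dihedral_maps"
  by (auto simp: dihedral_maps_def fun_eq_iff)

lemma word_map_dihedral: "word_map n w \<in> dihedral_maps"
proof (induction w)
  case Nil
  show ?case
    by (rule dihedral_mapsI[of 1 _ 0]) simp_all
next
  case (Cons p w)
  then obtain b s where bs: "s = 1 \<or> s = -1" "word_map n w = (\<lambda>z. b + s * z)"
    by (auto simp: dihedral_maps_def)
  consider "fst p = 2 * n" | "fst p = 2 * n + 1" | "fst p \<noteq> 2 * n" "fst p \<noteq> 2 * n + 1"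
    by blast
  then show ?case
  proof cases
    case 1
    then show ?thesis
      using bs by (intro dihedral_mapsI[of "- s" _ "- b"]) (auto simp: letter_map_def)
  next
    case 2
    then show ?thesis
      using bs by (intro dihedral_mapsI[of s _ "(if snd p then 1 else -1) + b"])
        (auto simp: letter_map_def)
  next
    case 3
    then show ?thesis
      using bs by (intro dihedral_mapsI[of s _ b]) (auto simp: letter_map_def)
  qed
qed

lemma word_map_finite: "finite {n. word_map n w \<noteq> id}"
proof (induction w)
  case (Cons p w)
  have "letter_map n p = id" if "n \<noteq> fst p div 2" for n
    using that by (auto simp: letter_map_def fun_eq_iff)
  then have "{n. word_map n (p # w) \<noteq> id} \<subseteq> insert (fst p div 2) {n. word_map n w \<noteq> id}"
    by auto
  then show ?case
    using Cons finite_subset by blast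
qed simp

section \<open>Almost subnormal subgroups that are not subnormal\<close>

theorem theorem2p6:
  fixes \<Phi> :: "fword \<Rightarrow> 'k::division_ring \<Rightarrow> 'k"
    and r :: nat
  assumes "\<Phi> \<in> hom free_grp ring_aut_grp"
    and "r > 0"
  shows "\<exists>N. almost_subnormal (mult_of (malcev_neumann \<Phi>)) r N \<and>
             \<not> subnormal (mult_of (malcev_neumann \<Phi>)) N"
proof -
  interpret D: twisted_series free_grp dict_less \<Phi>
    using assms(1) by (rule twisted_series_free_grp)
  have gen: "[p] \<in> carrier free_grp" for p
    by (simp add: carrier_free_grp)
  interpret dihedral_coordinates D.nonzero_group "\<lambda>n \<alpha>. word_map n (D.lead \<alpha>)"
    "\<lambda>n. D.monomial [(2 * n, True)]" "\<lambda>n. D.monomial [(2 * n + 1, True)]"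
  proof (intro dihedral_coordinates.intro dihedral_coordinates_axioms.intro D.group_nonzero_group)
  qed (simp_all add: word_map_dihedral word_map_finite D.lead_mult word_map_mult D.monomial_closed
      gen D.lead_monomial letter_map_def)
  show ?thesis
    using almost_subnormal_not_subnormal[OF assms(2)] mult_of_malcev_neumann[OF assms(1)] by auto
qed

end
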